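(* Let $p$ be an odd prime and let $C$ and $D$ be self-orthogonal codes of length $k$ over $\mathbb{F}_p$. Then $L_A(C)\cong L_A(D)$ as lattices if and only if $C\cong D$ as codes.
   Context: A code of length $k$ over $\mathbb{F}_p$ is a subspace of $\mathbb{F}_p^k$, with the standard dot product $(x,y)=\sum_i x_iy_i$; $C^\perp$ is the dual code and $C$ is self-orthogonal if $C\subset C^\perp$. Two codes $C,D$ of length $k$ are isomorphic if $f(C)=D$ for some $f$ in the group generated by coordinate permutations and the maps $\sigma_i$ multiplying the $i$-th coordinate by $-1$. For $n\ge 2$, let $A_{n-1}=\{x\in\mathbb{Z}^n:\sum_i x_i=0\}$ with the standard inner product of $\mathbb{R}^n$, $e_1,\dots,e_n$ the standard basis, $\alpha_i=e_i-e_{i+1}$, and $\varepsilon_1=e_1-\frac1n(e_1+\cdots+e_n)$; the dual lattice $A_{n-1}^*$ satisfies $A_{n-1}^*/A_{n-1}=\langle \varepsilon_1+A_{n-1}\rangle\cong\mathbb{Z}/n$. For a prime $p$ identify $\mathbb{F}_p^k$ with $(A_{p-1}^*/A_{p-1})^k$ via $(a_1,\dots,a_k)\mapsto(a_1\varepsilon_1+A_{p-1},\dots,a_k\varepsilon_1+A_{p-1})$, and let $\pi:(A_{p-1}^* )^k\to(A_{p-1}^*/A_{p-1})^k$ be the quotient map. Construction A: $L_A(C)=\pi^{-1}(C)\subset\mathbb{R}^{pk}$, a lattice with the standard inner product. Lattices are isomorphic if there is an inner-product-preserving group isomorphism between them. *)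

theory Defs
  imports
    "HOL-Analysis.Analysis"
    "HOL-Algebra.Bij"
    "HOL-Algebra.Generated_Groups"
    "Berlekamp_Zassenhaus.Finite_Field"
begin

text \<open>
  The prime field with p elements is \<open>'p mod_ring\<close> with \<open>'p :: prime_card\<close> and \<open>p = CARD('p)\<close>.
  A code of length \<open>k = CARD('k)\<close> over it is a set \<open>C :: ('p mod_ring ^ 'k) set\<close> with
  \<open>vec.subspace C\<close>.
\<close>

definition code_dot :: "'a::comm_ring_1 ^ 'k \<Rightarrow> 'a ^ 'k \<Rightarrow> 'a"
  where "code_dot x y = (\<Sum>i\<in>UNIV. x $ i * y $ i)"

definition dual_code :: "('a::comm_ring_1 ^ 'k) set \<Rightarrow> ('a ^ 'k) set"
  where "dual_code C = {y. \<forall>x\<in>C. code_dot x y = 0}"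

definition self_orthogonal :: "('a::comm_ring_1 ^ 'k) set \<Rightarrow> bool"
  where "self_orthogonal C \<longleftrightarrow> C \<subseteq> dual_code C"

definition coord_perm :: "('k \<Rightarrow> 'k) \<Rightarrow> 'a ^ 'k \<Rightarrow> 'a ^ 'k"
  where "coord_perm s x = (\<chi> i. x $ s i)"

definition coord_neg :: "'k \<Rightarrow> 'a::comm_ring_1 ^ 'k \<Rightarrow> 'a ^ 'k"
  where "coord_neg i x = (\<chi> j. if j = i then - (x $ j) else x $ j)"

definition signed_perms :: "('a::comm_ring_1 ^ 'k \<Rightarrow> 'a ^ 'k) set"
  where "signed_perms =
    generate (BijGroup UNIV) ({coord_perm s | s. s permutes UNIV} \<union> range coord_neg)"

definition code_isomorphic :: "('a::comm_ring_1 ^ 'k) set \<Rightarrow> ('a ^ 'k) set \<Rightarrow> bool"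
  where "code_isomorphic C D \<longleftrightarrow> (\<exists>f\<in>signed_perms. f ` C = D)"

definition lattice_isomorphic :: "'a::real_inner set \<Rightarrow> 'b::real_inner set \<Rightarrow> bool"
  where "lattice_isomorphic L M \<longleftrightarrow>
    (\<exists>f. bij_betw f L M \<and>
         (\<forall>x\<in>L. \<forall>y\<in>L. f (x + y) = f x + f y) \<and>
         (\<forall>x\<in>L. \<forall>y\<in>L. f x \<bullet> f y = x \<bullet> y))"

text \<open>The dual is taken inside the real span of the lattice, which need not be the whole space.\<close>

definition dual_lattice :: "'a::real_inner set \<Rightarrow> 'a set"
  where "dual_lattice L = {y \<in> span L. \<forall>x\<in>L. x \<bullet> y \<in> \<int>}"

text \<open>The root lattice $A_{n-1}$ in $\mathbb{R}^n$, where \<open>n = CARD('n)\<close>.\<close>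

definition A_lattice :: "(real ^ 'n) set"
  where "A_lattice = {x. (\<forall>i. x $ i \<in> \<int>) \<and> (\<Sum>i\<in>UNIV. x $ i) = 0}"

definition eps :: "'n \<Rightarrow> real ^ 'n"
  where "eps i = axis i 1 - (1 / real CARD('n)) *\<^sub>R (\<Sum>j\<in>UNIV. axis j 1)"

definition A_coset :: "real ^ 'n \<Rightarrow> (real ^ 'n) set"
  where "A_coset v = (+) v ` A_lattice"

text \<open>
  For $n = p$ the coordinates of $\mathbb{R}^p$ are indexed by the residues modulo p, so the
  first basis vector is \<open>axis 1 1\<close>. Elements of $(A_{p-1}^*/A_{p-1})^k$ are vectors of cosets.
\<close>

definition glue_embed :: "'p::prime_card mod_ring ^ 'k \<Rightarrow> (real ^ 'p mod_ring) set ^ 'k"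
  where "glue_embed a = (\<chi> i. A_coset (of_int (to_int_mod_ring (a $ i)) *\<^sub>R eps 1))"

definition glue_proj :: "real ^ 'n ^ 'k \<Rightarrow> (real ^ 'n) set ^ 'k"
  where "glue_proj x = (\<chi> i. A_coset (x $ i))"

definition construction_A :: "('p::prime_card mod_ring ^ 'k) set \<Rightarrow> (real ^ 'p mod_ring ^ 'k) set"
  where "construction_A C =
    {x. (\<forall>i. x $ i \<in> dual_lattice A_lattice) \<and> glue_proj x \<in> glue_embed ` C}"

end

theory Submission
  imports Defs
begin

text \<open>
  A signed coordinate permutation of codes lifts to an isometry of the lattices. Conversely, call
  the vectors of norm 2 roots. If an isometry maps every component $A_{p-1}$ of the first lattice to
  a component of the second one, then it permutes the components, acting on each by a signed
  permutation of coordinates and hence by a sign on $A_{p-1}^*/A_{p-1}$, which gives a code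
  isomorphism. For $p \le 5$ there may be roots outside the components and an isometry need not
  respect them, but it can be corrected by reflections in roots of the target. The roots
  $e_o - e_q$ of a component are mapped to roots having pairwise product 1, and these are moved into
  a component one at a time: a root \<open>s\<close> is moved to a root \<open>t\<close> with \<open>s \<bullet> t = 1\<close> by the reflection in
  \<open>s - t\<close>, which fixes every vector having equal products with both. A bound on norms shows that a
  single reflection suffices, except for $p = 5$, where two may be needed.
\<close>

section \<open>Roots of the components\<close>

definition croot :: "'k::finite \<Rightarrow> 'n::finite \<Rightarrow> 'n \<Rightarrow> real ^ 'n ^ 'k"
  where "croot i a b = axis i (axis a 1 - axis b 1)"

lemma inner_croot [simp]: "x \<bullet> croot i a b = x $ i $ a - x $ i $ b"
  by (simp add: croot_def inner_axis inner_diff_right)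

lemma croot_nth_other [simp]: "j \<noteq> i \<Longrightarrow> croot i a b $ j = 0"
  by (simp add: croot_def axis_def)

lemma croot_nth_same: "croot i a b $ i = axis a 1 - axis b 1"
  by (simp add: croot_def)

lemma croot_nth_nth: "croot i a b $ i $ c = (if c = a then 1 else 0) - (if c = b then 1 else 0)"
  by (simp add: croot_nth_same axis_def)

lemma minus_croot: "- croot i a b = croot i b a"
  by (simp add: vec_eq_iff croot_def axis_def)

lemma croot_diff: "croot i a c - croot i a b = croot i b c"
  by (simp add: vec_eq_iff croot_def axis_def)

lemma croot_refl [simp]: "croot i a a = 0"
  by (simp add: vec_eq_iff croot_def axis_def)

lemma Ints_add_one_le:
  fixes x y :: real
  assumes "x \<in> \<int>" "y \<in> \<int>" "x < y"
  shows "x + 1 \<le> y"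
  using assms by (auto elim!: Ints_cases)

text \<open>A constant vector sums to a nonzero multiple of its value. This turns orthogonality to
  all roots of a component into vanishing on that component.\<close>

lemma coords_eq_0_if_constant_balanced:
  fixes v :: "real ^ 'n"
  assumes "\<And>a b. v $ a = v $ b" and "(\<Sum>a\<in>UNIV. v $ a) = 0"
  shows "v = 0"
proof -
  have "(\<Sum>a\<in>(UNIV::'n set). v $ a) = (\<Sum>a\<in>(UNIV::'n set). v $ undefined)"
    by (rule sum.cong) (use assms(1) in auto)
  then have "v $ undefined = 0" using assms(2) by simp
  then have "v $ a = 0" for a using assms(1)[of a undefined] by simp
  then show ?thesis by (simp add: vec_eq_iff)
qed

lemma inner_eq_0_if_disjoint_support:
  fixes v s :: "'a::real_inner ^ 'k"
  assumes "\<And>j. s $ j \<noteq> 0 \<Longrightarrow> v $ j = 0"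
  shows "v \<bullet> s = 0"
  unfolding inner_vec_def using assms by (intro sum.neutral) (metis inner_zero_left inner_zero_right)

lemma inner_croot_self: "a \<noteq> b \<Longrightarrow> croot i a b \<bullet> croot i a b = 2"
  by (simp add: croot_nth_nth)

text \<open>Both claims express positivity of the norm of \<open>s - t\<close>, which is
  \<open>4 - 2 * (s \<bullet> t)\<close>.\<close>

lemma root_inner_le:
  fixes s t :: "'a::real_inner"
  assumes "s \<bullet> s = 2" "t \<bullet> t = 2"
  shows "s \<bullet> t \<le> 2" and "s \<bullet> t = 2 \<Longrightarrow> s = t"
proof -
  have eq: "(s - t) \<bullet> (s - t) = 4 - 2 * (s \<bullet> t)"
    using assms by (simp add: inner_diff_left inner_diff_right inner_commute)
  show "s \<bullet> t \<le> 2"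
    using inner_ge_zero[of "s - t"] eq by linarith
  show "s = t" if "s \<bullet> t = 2"
    using eq that by simp
qed

lemma sum_inner_two_components_le:
  fixes s :: "real ^ 'n ^ 'k"
  assumes "i \<noteq> j"
  shows "s $ i \<bullet> s $ i + s $ j \<bullet> s $ j \<le> s \<bullet> s"
proof -
  have "(\<Sum>l\<in>{i, j}. s $ l \<bullet> s $ l) \<le> (\<Sum>l\<in>UNIV. s $ l \<bullet> s $ l)"
    by (rule sum_mono2) auto
  then show ?thesis using assms by (simp add: inner_vec_def)
qed

text \<open>Balance determines \<open>y\<close>, and the squares are then summed over
  \<open>N\<close> and its complement. The value is the norm of a fundamental weight of type A,
  which is the shape of the components met in \<open>exists_linking_root\<close>.\<close>

lemma two_valued_norm:
  fixes x :: "real ^ 'n"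
  assumes "\<And>a. x $ a = (if a \<in> N then y else y + 1)" and "(\<Sum>a\<in>UNIV. x $ a) = 0"
  shows "real CARD('n) * (x \<bullet> x) = real (card N) * (real CARD('n) - real (card N))"
proof -
  let ?p = "real CARD('n)" and ?n = "real (card N)"
  have split: "(\<Sum>a\<in>UNIV. (if a \<in> N then u else v)) = ?n * u + (?p - ?n) * v" for u v :: real
  proof -
    have "(\<Sum>a\<in>(UNIV::'n set). (if a \<in> N then u else v)) = (\<Sum>a\<in>N. u) + (\<Sum>a\<in>-N. v)"
      by (subst sum.If_cases) (auto simp: Compl_eq)
    also have "real (card (- N)) = ?p - ?n"
      by (simp add: Compl_eq_Diff_UNIV card_Diff_subset of_nat_diff card_mono)
    then have "(\<Sum>a\<in>N. u) + (\<Sum>a\<in>-N. v) = ?n * u + (?p - ?n) * v" by simp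
    finally show ?thesis .
  qed
  have "(\<Sum>a\<in>UNIV. x $ a) = ?n * y + (?p - ?n) * (y + 1)"
    using split[of y "y + 1"] by (simp add: assms(1))
  then have y: "?p * y = ?n - ?p" using assms(2) by (simp add: algebra_simps)
  have "x \<bullet> x = (\<Sum>a\<in>UNIV. (if a \<in> N then y * y else (y + 1) * (y + 1)))"
    unfolding inner_vec_def by (rule sum.cong) (auto simp: assms(1))
  also have "\<dots> = ?n * (y * y) + (?p - ?n) * ((y + 1) * (y + 1))" by (rule split)
  finally have "?p * (x \<bullet> x) = ?p * (?n * (y * y) + (?p - ?n) * ((y + 1) * (y + 1)))"
    by simp
  also have "\<dots> = (?p * y) * (?p * y + 2 * (?p - ?n)) + ?p * (?p - ?n)"
    by (simp add: algebra_simps)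
  finally have "?p * (x \<bullet> x) = (?p * y) * (?p * y + 2 * (?p - ?n)) + ?p * (?p - ?n)" .
  then show ?thesis unfolding y by (simp add: algebra_simps)
qed

section \<open>Moving roots by reflections\<close>

text \<open>Abstracts what Construction A yields for a self-orthogonal code: an integral lattice
  that contains the root lattice of every component and lies in the real span of these root
  lattices.\<close>

locale framed_lattice =
  fixes M :: "(real ^ 'n ^ 'k) set"
  assumes diff_closed: "x \<in> M \<Longrightarrow> y \<in> M \<Longrightarrow> x - y \<in> M"
    and integral: "x \<in> M \<Longrightarrow> y \<in> M \<Longrightarrow> x \<bullet> y \<in> \<int>"
    and balanced: "x \<in> M \<Longrightarrow> (\<Sum>a\<in>UNIV. x $ i $ a) = 0"
    and croot_mem: "croot i a b \<in> M"
begin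

section \<open>Lattice operations, automorphisms and reflections\<close>

lemma zero_mem: "0 \<in> M"
  using croot_mem[of undefined undefined undefined] by simp

lemma uminus_closed: "x \<in> M \<Longrightarrow> - x \<in> M"
  using diff_closed[OF zero_mem] by simp

lemma add_closed: "x \<in> M \<Longrightarrow> y \<in> M \<Longrightarrow> x + y \<in> M"
  using diff_closed[of x "- y"] uminus_closed by simp

lemma scale_int_closed:
  assumes "x \<in> M" "c \<in> \<int>"
  shows "c *\<^sub>R x \<in> M"
proof -
  have nat: "real n *\<^sub>R x \<in> M" for n
    by (induction n) (auto simp: zero_mem scaleR_left_distrib intro: add_closed assms)
  from assms(2) obtain z where "c = of_int z" by (auto elim: Ints_cases)
  then show ?thesis
    using nat[of "nat z"] uminus_closed[OF nat[of "nat (- z)"]]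
    by (cases "z \<ge> 0") auto
qed

lemma coord_diff_Ints: "x \<in> M \<Longrightarrow> x $ i $ a - x $ i $ b \<in> \<int>"
  using integral[OF _ croot_mem, of x i a b] by simp

text \<open>The map acts on the whole space, not only on \<open>M\<close>, so that it makes sense to
  say that it fixes vectors outside \<open>M\<close>; \<open>star_into_component\<close> relies on
  this.\<close>

definition autom :: "(real ^ 'n ^ 'k \<Rightarrow> real ^ 'n ^ 'k) \<Rightarrow> bool"
  where "autom w \<longleftrightarrow> orthogonal_transformation w \<and> w ` M = M"

lemma autom_id: "autom (\<lambda>x. x)"
  by (simp add: autom_def orthogonal_transformation)

lemma autom_compose: "autom v \<Longrightarrow> autom w \<Longrightarrow> autom (\<lambda>x. v (w x))"
  unfolding autom_def orthogonal_transformation_def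
  using linear_compose[of w v] by (auto simp: comp_def image_image[symmetric])

lemma autom_linear: "autom w \<Longrightarrow> linear w"
  by (simp add: autom_def orthogonal_transformation_def)

lemma autom_inner: "autom w \<Longrightarrow> w x \<bullet> w y = x \<bullet> y"
  by (simp add: autom_def orthogonal_transformation_def)

lemma autom_mem: "autom w \<Longrightarrow> x \<in> M \<Longrightarrow> w x \<in> M"
  by (auto simp: autom_def)

text \<open>By integrality the coefficient \<open>x \<bullet> r\<close> is an integer for
  \<open>x\<close> in \<open>M\<close>, so \<open>M\<close> is mapped into itself; the map is an
  involution, so the image is all of \<open>M\<close>.\<close>

lemma reflection_autom:
  assumes "r \<in> M" "r \<bullet> r = 2"
  shows "autom (\<lambda>x. x - (x \<bullet> r) *\<^sub>R r)"
proof -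
  let ?w = "\<lambda>x. x - (x \<bullet> r) *\<^sub>R r"
  have "linear ?w"
    by (rule linearI) (simp_all add: inner_add_left scaleR_left_distrib algebra_simps)
  moreover have "?w x \<bullet> ?w y = x \<bullet> y" for x y
    using assms(2) by (simp add: inner_diff_left inner_diff_right inner_commute)
  moreover have sub: "?w x \<in> M" if "x \<in> M" for x
    using that assms by (intro diff_closed scale_int_closed integral)
  moreover have "?w (?w x) = x" for x
    using assms(2) by (simp add: inner_diff_left algebra_simps)
  then have "M \<subseteq> ?w ` M"
    using sub by (metis (no_types, lifting) image_eqI subsetI)
  ultimately show ?thesis
    unfolding autom_def orthogonal_transformation_def by blast
qed

text \<open>Integrality leaves only the products 1 and 2. At 2 the roots coincide; at 1 their
  difference is again a root, and its reflection moves \<open>s\<close> to \<open>t\<close>.\<close>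

lemma move_root:
  assumes "s \<in> M" "t \<in> M" "s \<bullet> s = 2" "t \<bullet> t = 2" "s \<bullet> t \<ge> 1"
  obtains w where "autom w" "w s = t" "\<And>v. v \<bullet> s = v \<bullet> t \<Longrightarrow> w v = v"
proof (cases "s = t")
  case True
  then show ?thesis using that[OF autom_id] by blast
next
  case False
  have "s \<bullet> t \<noteq> 2" "s \<bullet> t \<le> 2"
    using root_inner_le[OF assms(3,4)] False by auto
  then have st: "s \<bullet> t = 1"
    using assms(5) Ints_add_one_le[OF integral[OF assms(1,2)], of 2] by force
  let ?w = "\<lambda>x. x - (x \<bullet> (s - t)) *\<^sub>R (s - t)"
  have "(s - t) \<bullet> (s - t) = 2"
    using st assms(3,4) by (simp add: inner_diff_left inner_diff_right inner_commute)
  then have "autom ?w"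
    using diff_closed[OF assms(1,2)] by (intro reflection_autom)
  moreover have "?w s = t"
    using st assms(3) by (simp add: inner_diff_right)
  moreover have "?w v = v" if "v \<bullet> s = v \<bullet> t" for v
    using that by (simp add: inner_diff_right)
  ultimately show ?thesis by (rule that)
qed

text \<open>The difference is the integer \<open>s \<bullet> croot j u v\<close>, and the product of
  two distinct roots is less than 2.\<close>

lemma coord_diff_le_one:
  assumes "s \<in> M" "s \<bullet> s = 2" "s \<noteq> croot j u v"
  shows "s $ j $ u - s $ j $ v \<le> 1"
proof (cases "u = v")
  case False
  then have "s \<bullet> croot j u v < 2"
    using root_inner_le[OF assms(2) inner_croot_self[OF False, of j]] assms(3) by force
  then show ?thesis
    using Ints_add_one_le[OF coord_diff_Ints[OF assms(1)], of 2 j u v] by simp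
qed simp

text \<open>A nonzero balanced component is not constant, and unequal coordinates differ by a
  nonzero integer.\<close>

lemma exists_coord_diff_ge_one:
  assumes "s \<in> M" "s $ j \<noteq> 0"
  obtains u v where "s $ j $ u - s $ j $ v \<ge> 1"
proof -
  have "\<exists>u v. s $ j $ u \<noteq> s $ j $ v"
    using coords_eq_0_if_constant_balanced[OF _ balanced[OF assms(1)]] assms(2) by blast
  then obtain u v where uv: "s $ j $ u > s $ j $ v"
    by (meson linorder_neqE_linordered_idom)
  then have "s $ j $ u - s $ j $ v \<ge> 1"
    using Ints_add_one_le[OF Ints_0 coord_diff_Ints[OF assms(1)], of j u v] by simp
  then show ?thesis by (rule that)
qed

text \<open>The vector \<open>z\<close> is a sum of two roots at angle 60 degrees, both having product 1 with \<open>s\<close>;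
  by Cauchy--Schwarz it certifies that the component of \<open>s\<close> has norm at least 2/3.\<close>

lemma component_certificate:
  assumes "CARD('n) \<ge> 3" "s \<in> M" "s \<bullet> s = 2" "s $ j \<noteq> 0" "s $ i \<noteq> 0" "i \<noteq> j"
  obtains r z where "r \<in> M" "z \<in> M" "\<And>l. l \<noteq> j \<Longrightarrow> r $ l = 0 \<and> z $ l = 0"
    "r \<bullet> r = 2" "s \<bullet> r = 1" "z \<bullet> z = 6" "s \<bullet> z = 2"
proof -
  \<comment> \<open>Being nonzero in the two components \<open>i\<close> and \<open>j\<close>, the
    root \<open>s\<close> is none of the \<open>croot j u v\<close>.\<close>
  have le: "s $ j $ u - s $ j $ v \<le> 1" for u v
    using assms by (intro coord_diff_le_one) auto
  obtain u v where uv: "s $ j $ u - s $ j $ v = 1"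
    using exists_coord_diff_ge_one[OF assms(2,4)] le by (metis order_antisym)
  then have "u \<noteq> v" by auto
  have "card {u, v} \<noteq> CARD('n)" using assms(1) \<open>u \<noteq> v\<close> by simp
  then have "{u, v} \<noteq> UNIV" by metis
  then obtain l where l: "l \<noteq> u" "l \<noteq> v" by blast
  \<comment> \<open>The differences from \<open>u\<close> to \<open>l\<close> and from
    \<open>l\<close> to \<open>v\<close> are integers, at most 1, with sum 1; so one of them is 1
    and the other 0.\<close>
  consider "s $ j $ u - s $ j $ l = 1" | "s $ j $ l - s $ j $ v = 1"
    using Ints_add_one_le[OF Ints_0 coord_diff_Ints[OF assms(2)], of j u l]
      le[of u l] le[of l v] uv by linarith
  then show ?thesis
  proof cases
    case 1
    show ?thesis
      by (rule that[of "croot j u v" "croot j u v + croot j u l"])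
        (use 1 uv l \<open>u \<noteq> v\<close> in \<open>auto simp: croot_mem add_closed inner_add_right croot_nth_nth\<close>)
  next
    case 2
    show ?thesis
      by (rule that[of "croot j u v" "croot j u v + croot j l v"])
        (use 2 uv l \<open>u \<noteq> v\<close> in \<open>auto simp: croot_mem add_closed inner_add_right croot_nth_nth\<close>)
  qed
qed

text \<open>The exceptional case: here \<open>s\<close> and the target root are orthogonal, and a third root \<open>t\<close>
  having product 1 with both links them. It exists only for five coordinates (the case of
  $A_4 \oplus A_4$ inside $E_8$).\<close>

lemma exists_linking_root:
  assumes "prime CARD('n)" "odd CARD('n)"
    and s: "s \<in> M" "s \<bullet> s = 2"
    and N: "A \<notin> N" "card N \<ge> 2" "l \<notin> N" "l \<noteq> A"
    and x: "\<And>a. s $ i $ a = (if a \<in> N then y else y + 1)"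
  obtains t where "t \<in> M" "t \<bullet> t = 2" "s \<bullet> t = 1" "t \<bullet> croot i A l = 1"
    "\<And>b. b \<in> N \<Longrightarrow> t \<bullet> croot i A b = 1" "\<And>j. s $ j = 0 \<Longrightarrow> t $ j = 0"
proof -
  let ?p = "CARD('n)" and ?n = "card N"
  have "card (insert A (insert l N)) \<le> ?p" by (rule card_mono) auto
  then have np: "?n + 2 \<le> ?p" using N by simp
  have norm: "real ?p * (s $ i \<bullet> s $ i) = real ?n * (real ?p - real ?n)"
    using two_valued_norm[OF x balanced[OF s(1)]] .
  have si: "s $ i \<noteq> 0"
  proof
    assume "s $ i = 0"
    then show False using norm np N(2) by simp
  qed
  \<comment> \<open>If \<open>s\<close> lived in component \<open>i\<close> alone, the norm formula
    would read \<open>2 * p = n * (p - n)\<close>, and the prime \<open>p\<close> would divide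
    \<open>n\<close> or \<open>p - n\<close>, both of which lie strictly between 0 and
    \<open>p\<close>.\<close>
  have "\<exists>j. j \<noteq> i \<and> s $ j \<noteq> 0"
  proof (rule ccontr)
    assume "\<not> ?thesis"
    then have "s \<bullet> s = (\<Sum>j\<in>UNIV. if j = i then s $ i \<bullet> s $ i else 0)"
      unfolding inner_vec_def[of s s] by (intro sum.cong) auto
    then have "s \<bullet> s = s $ i \<bullet> s $ i" by simp
    then have "real (?p * 2) = real (?n * (?p - ?n))"
      using norm s(2) np by (simp add: of_nat_diff)
    then have "?p dvd ?n * (?p - ?n)"
      by (metis dvd_triv_left of_nat_eq_iff)
    then have "?p dvd ?n \<or> ?p dvd ?p - ?n"
      using assms(1) by (simp add: prime_dvd_mult_iff)
    then show False
      using np N(2) by (auto dest!: dvd_imp_le)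
  qed
  then obtain j where j: "j \<noteq> i" "s $ j \<noteq> 0" by blast
  have p3: "?p \<ge> 3" using np N(2) by linarith
  obtain r z where rz: "r \<in> M" "z \<in> M" "\<And>l. l \<noteq> j \<Longrightarrow> r $ l = 0 \<and> z $ l = 0"
    "r \<bullet> r = 2" "s \<bullet> r = 1" "z \<bullet> z = 6" "s \<bullet> z = 2"
    using component_certificate[OF p3 s j(2) si] j(1) by metis
  have comp: "v \<bullet> z = v $ j \<bullet> z $ j" for v
  proof -
    have "v \<bullet> z = (\<Sum>q\<in>UNIV. if q = j then v $ j \<bullet> z $ j else 0)"
      unfolding inner_vec_def[of v z] using rz(3) by (intro sum.cong) auto
    then show ?thesis by simp
  qed
  \<comment> \<open>The products 2 and 6 give component \<open>j\<close> norm at least 4/6, which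
    leaves at most 4/3 for component \<open>i\<close>.\<close>
  have "(s $ j \<bullet> z $ j)\<^sup>2 \<le> (s $ j \<bullet> s $ j) * (z $ j \<bullet> z $ j)"
    by (rule Cauchy_Schwarz_ineq)
  then have "s $ j \<bullet> s $ j \<ge> 2 / 3"
    using rz(6,7) comp[of s] comp[of z] by simp
  then have "s $ i \<bullet> s $ i \<le> 4 / 3"
    using sum_inner_two_components_le[of i j s] j(1) s(2) by simp
  then have "real ?p * (s $ i \<bullet> s $ i) \<le> real ?p * (4 / 3)"
    by (intro mult_left_mono) auto
  then have bound: "3 * (real ?n * (real ?p - real ?n)) \<le> 4 * real ?p"
    unfolding norm by simp
  define K where "K = real ?n * (real ?p - real ?n)"
  \<comment> \<open>Since \<open>n\<close> lies between 2 and \<open>p - 2\<close>, the product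
    \<open>n * (p - n)\<close> is at least \<open>2 * (p - 2)\<close>. Against the upper bound
    \<open>4 * p / 3\<close> this forces \<open>p \<le> 6\<close>, and parity leaves only 5.\<close>
  have "0 \<le> (real ?n - 2) * (real ?p - real ?n - 2)"
    using np N(2) by (intro mult_nonneg_nonneg) linarith+
  also have "\<dots> = K - 2 * (real ?p - 2)"
    by (simp add: K_def algebra_simps)
  finally have "2 * real ?p \<le> K + 4" by (simp add: algebra_simps)
  then have "real ?p \<le> 6" using bound[folded K_def] by linarith
  then have "?p \<le> 6" by linarith
  moreover have "?p \<ge> 4" "?p \<noteq> 4" "?p \<noteq> 6"
    using np N(2) assms(2) by auto
  ultimately have p5: "?p = 5" by linarith
  then have "?n = 2 \<or> ?n = 3" using np N(2) by linarith
  have ri: "r $ i = 0" "z $ i = 0" using rz(3) j(1) by auto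
  have orth: "croot i a b \<bullet> r = 0" "croot i a b \<bullet> z = 0" for a b
    using ri by (simp_all add: inner_commute[of "croot i a b"])
  have rest: "card (- N - {A, l}) = 3 - ?n"
    using N p5 by (simp add: Compl_eq_Diff_UNIV card_Diff_subset)
  from \<open>?n = 2 \<or> ?n = 3\<close> show ?thesis
  proof
    assume n2: "?n = 2"
    then obtain b c where bc: "N = {b, c}" "b \<noteq> c" by (meson card_2_iff)
    obtain l' where "- N - {A, l} = {l'}" using rest n2 by (auto simp: card_1_singleton_iff)
    then have l': "l' \<notin> N" "l' \<noteq> A" "l' \<noteq> l" by auto
    \<comment> \<open>Component \<open>i\<close> of \<open>s\<close> is -3/5 on \<open>N\<close> and
      2/5 elsewhere. Subtracting \<open>q\<close> from its double leaves 4/5 at \<open>A\<close> and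
      -1/5 elsewhere, a vector with product 1 with every \<open>croot i A a\<close> for
      \<open>a \<noteq> A\<close>. Subtracting \<open>r\<close> in component \<open>j\<close> brings
      the total norm down to 2.\<close>
    define q where "q = croot i l b + croot i l' c"
    define t where "t = 2 *\<^sub>R s - q - r"
    have q: "q \<in> M" "q \<bullet> q = 4" "s \<bullet> q = 2" "q \<bullet> r = 0"
      using N l' bc x orth unfolding q_def
      by (auto simp: add_closed croot_mem inner_add_right inner_add_left croot_nth_nth)
    have t: "t \<in> M" "t \<bullet> t = 2" "s \<bullet> t = 1"
      using q rz s unfolding t_def
      by (auto simp: diff_closed scale_int_closed inner_diff_left inner_diff_right inner_commute)
    moreover have "t \<bullet> croot i A l = 1" "\<And>b. b \<in> N \<Longrightarrow> t \<bullet> croot i A b = 1"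
      using N l' bc x ri unfolding t_def q_def by (auto simp: croot_nth_nth)
    moreover have "t $ h = 0" if "s $ h = 0" for h
    proof -
      have "h \<noteq> i" "h \<noteq> j" using that si j by auto
      then show ?thesis using that rz(3) by (simp add: t_def q_def)
    qed
    ultimately show ?thesis using that by blast
  next
    assume n3: "?n = 3"
    then obtain b c d where bcd: "N = {b, c, d}" "b \<noteq> c" "b \<noteq> d" "c \<noteq> d"
      by (metis card_3_iff)
    \<comment> \<open>The same target vector in component \<open>i\<close>, now reached from the
      triple of \<open>s\<close>, whose entries there are -6/5 on \<open>N\<close> and 9/5 at
      \<open>A\<close> and \<open>l\<close>. The norm correction in component \<open>j\<close> is
      made by \<open>z\<close>.\<close>
    define q where "q = croot i A b + croot i l c + croot i l d"
    define t where "t = 3 *\<^sub>R s - q - z"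
    have q: "q \<in> M" "q \<bullet> q = 8" "s \<bullet> q = 3" "q \<bullet> z = 0"
      using N bcd x orth unfolding q_def
      by (auto simp: add_closed croot_mem inner_add_right inner_add_left croot_nth_nth)
    have t: "t \<in> M" "t \<bullet> t = 2" "s \<bullet> t = 1"
      using q rz s unfolding t_def
      by (auto simp: diff_closed scale_int_closed inner_diff_left inner_diff_right inner_commute)
    moreover have "t \<bullet> croot i A l = 1" "\<And>b. b \<in> N \<Longrightarrow> t \<bullet> croot i A b = 1"
      using N bcd x ri unfolding t_def q_def by (auto simp: croot_nth_nth)
    moreover have "t $ h = 0" if "s $ h = 0" for h
    proof -
      have "h \<noteq> i" "h \<noteq> j" using that si j by auto
      then show ?thesis using that rz(3) by (simp add: t_def q_def)
    qed
    ultimately show ?thesis using that by blast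
  qed
qed

text \<open>The induction step once at least two roots are in place. One reflection suffices if
  \<open>s\<close> has positive product with some \<open>croot i A l\<close> for a fresh
  \<open>l\<close>; otherwise component \<open>i\<close> of \<open>s\<close> takes exactly two
  values and a linking root is interposed.\<close>

lemma extend_star:
  assumes "prime CARD('n)" "odd CARD('n)"
    and s: "s \<in> M" "s \<bullet> s = 2"
    and N: "A \<notin> N" "card N \<ge> 2" "insert A N \<noteq> UNIV"
    and sN: "\<And>b. b \<in> N \<Longrightarrow> s \<bullet> croot i A b = 1"
  obtains w l where "autom w" "l \<notin> N" "l \<noteq> A" "w s = croot i A l"
    "\<And>b. b \<in> N \<Longrightarrow> w (croot i A b) = croot i A b"
    "\<And>v :: real ^ 'n ^ 'k. (\<And>j. s $ j \<noteq> 0 \<Longrightarrow> v $ j = 0) \<Longrightarrow> w v = v"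
proof -
  obtain b where b: "b \<in> N" using N(2) by fastforce
  have "s $ i \<noteq> 0"
  proof
    assume "s $ i = 0"
    then show False using sN[OF b] by simp
  qed
  then have vi: "v \<bullet> croot i a c = 0" if "\<And>j. s $ j \<noteq> 0 \<Longrightarrow> v $ j = 0"
    for v :: "real ^ 'n ^ 'k" and a c
    using that by simp
  show ?thesis
  proof (cases "\<exists>l. l \<notin> N \<and> l \<noteq> A \<and> s \<bullet> croot i A l \<ge> 1")
    case True
    then obtain l where l: "l \<notin> N" "l \<noteq> A" "s \<bullet> croot i A l \<ge> 1" by blast
    obtain w where w: "autom w" "w s = croot i A l"
      "\<And>v. v \<bullet> s = v \<bullet> croot i A l \<Longrightarrow> w v = v"
      using move_root[OF s(1) croot_mem s(2) inner_croot_self l(3)] l(2) by metis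
    show ?thesis
    proof (rule that[OF w(1) l(1,2) w(2)])
      fix b assume "b \<in> N"
      \<comment> \<open>A placed root has product 1 both with \<open>s\<close> and with
        \<open>croot i A l\<close>, so the reflection fixes it.\<close>
      then show "w (croot i A b) = croot i A b"
        using sN N(1) l by (intro w(3)) (auto simp: inner_commute[of _ s] croot_nth_nth)
    next
      fix v :: "real ^ 'n ^ 'k" assume v: "\<And>j. s $ j \<noteq> 0 \<Longrightarrow> v $ j = 0"
      then have "v \<bullet> s = 0" by (rule inner_eq_0_if_disjoint_support)
      then show "w v = v" using vi[OF v] by (intro w(3)) simp
    qed
  next
    case False
    \<comment> \<open>As no fresh index works, integrality makes every coordinate off
      \<open>N\<close> at least the one at \<open>A\<close>; the bound 1 on its difference from the
      coordinate at \<open>b\<close> gives equality.\<close>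
    have x: "s $ i $ a = (if a \<in> N then s $ i $ A - 1 else s $ i $ A - 1 + 1)" for a
    proof (cases "a \<in> N \<or> a = A")
      case True
      then show ?thesis using sN N(1) by (auto simp: algebra_simps)
    next
      case a: False
      then have "s $ i $ A - s $ i $ a < 1" using False by force
      then have "s $ i $ a \<ge> s $ i $ A"
        using Ints_add_one_le[OF coord_diff_Ints[OF s(1)] Ints_1] by force
      moreover have "s \<noteq> croot i a b"
      proof
        assume eq: "s = croot i a b"
        \<comment> \<open>A second element \<open>b'\<close> of \<open>N\<close> would give
          \<open>croot i a b\<close> product 0 with \<open>croot i A b'\<close>, where
          \<open>s\<close> has product 1.\<close>
        have "card (N - {b}) > 0" using N(2) b by (simp add: card_gt_0_iff)
        then obtain b' where "b' \<in> N" "b' \<noteq> b" by (auto simp: card_gt_0_iff)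
        then show False
          using sN[of b'] a b N(1) unfolding eq by (auto simp: croot_nth_nth split: if_splits)
      qed
      then have "s $ i $ a - s $ i $ b \<le> 1" using s by (intro coord_diff_le_one)
      ultimately show ?thesis using sN[OF b] a by simp
    qed
    obtain l where l: "l \<notin> N" "l \<noteq> A" using N(3) by blast
    obtain t where t: "t \<in> M" "t \<bullet> t = 2" "s \<bullet> t = 1" "t \<bullet> croot i A l = 1"
      "\<And>b. b \<in> N \<Longrightarrow> t \<bullet> croot i A b = 1" "\<And>j. s $ j = 0 \<Longrightarrow> t $ j = 0"
      using exists_linking_root[OF assms(1,2) s N(1,2) l x] by blast
    \<comment> \<open>Two reflections, from \<open>s\<close> to \<open>t\<close> and from
      \<open>t\<close> to the target. Each placed root has product 1 with all three of these roots,
      so both reflections fix it.\<close>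
    obtain w1 where w1: "autom w1" "w1 s = t" "\<And>v. v \<bullet> s = v \<bullet> t \<Longrightarrow> w1 v = v"
      using move_root[OF s(1) t(1) s(2) t(2)] t(3) by (metis order_refl)
    obtain w2 where w2: "autom w2" "w2 t = croot i A l"
      "\<And>v. v \<bullet> t = v \<bullet> croot i A l \<Longrightarrow> w2 v = v"
      using move_root[OF t(1) croot_mem t(2) inner_croot_self] t(4) l(2) by (metis order_refl)
    show ?thesis
    proof (rule that[OF autom_compose[OF w2(1) w1(1)] l])
      show "w2 (w1 s) = croot i A l" using w1 w2 by simp
    next
      fix b assume "b \<in> N"
      then have "w1 (croot i A b) = croot i A b" "w2 (croot i A b) = croot i A b"
        using sN t(5) N(1) l
        by (auto intro!: w1(3) w2(3) simp: inner_commute[of _ s] inner_commute[of _ t] croot_nth_nth)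
      then show "w2 (w1 (croot i A b)) = croot i A b" by simp
    next
      fix v :: "real ^ 'n ^ 'k" assume v: "\<And>j. s $ j \<noteq> 0 \<Longrightarrow> v $ j = 0"
      then have "v \<bullet> s = 0" "v \<bullet> t = 0"
        using t(6) by (auto intro!: inner_eq_0_if_disjoint_support)
      then have "w1 v = v" "w2 v = v" using vi[OF v] by (auto intro!: w1(3) w2(3))
      then show "w2 (w1 v) = v" by simp
    qed
  qed
qed

text \<open>A family of roots with pairwise products 1 is a copy of the roots $e_o - e_q$ of a root
  lattice of type A. The automorphism moving it into one component is built by adding one root at
  a time, and it fixes everything supported on the set \<open>T\<close> of components orthogonal to the family.\<close>

lemma star_into_component:
  fixes b :: "'n \<Rightarrow> real ^ 'n ^ 'k"
  assumes pr: "prime CARD('n)" "odd CARD('n)"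
    and "o0 \<notin> S"
    and "\<And>q. q \<in> S \<Longrightarrow> b q \<in> M" "\<And>q. q \<in> S \<Longrightarrow> b q \<bullet> b q = 2"
    and "\<And>q q'. q \<in> S \<Longrightarrow> q' \<in> S \<Longrightarrow> q \<noteq> q' \<Longrightarrow> b q \<bullet> b q' = 1"
    and "\<And>q j. q \<in> S \<Longrightarrow> j \<in> T \<Longrightarrow> b q $ j = 0"
  shows "\<exists>w i \<eta> \<sigma>. autom w \<and> (\<forall>v :: real ^ 'n ^ 'k. (\<forall>j. j \<notin> T \<longrightarrow> v $ j = 0) \<longrightarrow> w v = v) \<and>
    \<eta> \<in> {1, -1} \<and> inj_on \<sigma> (insert o0 S) \<and>
    (\<forall>q\<in>S. w (b q) = \<eta> *\<^sub>R croot i (\<sigma> o0) (\<sigma> q))"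
proof -
  have "finite S" by simp
  then show ?thesis using assms(3-)
  proof (induction S rule: finite_induct)
    case empty
    show ?case
      by (rule exI[of _ "\<lambda>x. x"]) (auto simp: autom_id intro!: exI[of _ "1::real"])
  next
    case (insert c S)
    obtain w i \<eta> \<sigma> where w: "autom w"
        "\<And>v :: real ^ 'n ^ 'k. (\<And>j. j \<notin> T \<Longrightarrow> v $ j = 0) \<Longrightarrow> w v = v"
      and \<eta>: "\<eta> \<in> {1, - 1 :: real}" and \<sigma>: "inj_on \<sigma> (insert o0 S)"
      and wb: "\<And>q. q \<in> S \<Longrightarrow> w (b q) = \<eta> *\<^sub>R croot i (\<sigma> o0) (\<sigma> q)"
      using insert.IH insert.prems by (auto simp: Ball_def)
    have \<eta>2: "\<eta> * \<eta> = 1" using \<eta> by auto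
    have \<eta>\<eta>: "\<eta> *\<^sub>R \<eta> *\<^sub>R v = v" for v :: "real ^ 'n ^ 'k" using \<eta>2 by simp
    \<comment> \<open>The sign makes the products of the new root with the placed roots equal to +1
      whatever \<open>\<eta>\<close> is.\<close>
    define s where "s = \<eta> *\<^sub>R w (b c)"
    have wbc: "w (b c) = \<eta> *\<^sub>R s" unfolding s_def \<eta>\<eta> ..
    have "\<eta> \<in> \<int>" using \<eta> by auto
    then have s: "s \<in> M" "s \<bullet> s = 2"
      using insert.prems(2,3)[of c] w(1) \<eta>2
      by (auto simp: s_def scale_int_closed autom_mem autom_inner mult.assoc[symmetric])
    have sq: "s \<bullet> croot i (\<sigma> o0) (\<sigma> q) = 1" if "q \<in> S" for q
    proof -
      have "w (b c) \<bullet> w (b q) = 1"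
        using insert.prems(4)[of c q] that insert.hyps w(1) by (auto simp: autom_inner)
      then show ?thesis
        unfolding wb[OF that] s_def by (simp add: right_diff_distrib)
    qed
    have sT: "s $ j = 0" if "j \<in> T" for j
    proof -
      \<comment> \<open>The part of \<open>s\<close> in component \<open>j\<close> need not belong
        to \<open>M\<close>, but \<open>w\<close> fixes it as a vector of the ambient space and
        preserves products, so it is orthogonal to \<open>w (b c)\<close>, hence to itself.\<close>
      have "w (axis j (s $ j)) = axis j (s $ j)" using that by (intro w(2)) (auto simp: axis_def)
      then have "w (b c) \<bullet> axis j (s $ j) = b c \<bullet> axis j (s $ j)"
        using autom_inner[OF w(1), of "b c" "axis j (s $ j)"] by simp
      also have "\<dots> = 0" using insert.prems(5)[of c j] that by (simp add: inner_axis)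
      finally have "s $ j \<bullet> s $ j = 0" unfolding s_def by (simp add: inner_axis)
      then show ?thesis by simp
    qed
    then have supp: "v $ j = 0" if "\<And>j. j \<notin> T \<Longrightarrow> v $ j = 0" "s $ j \<noteq> 0"
      for v :: "real ^ 'n ^ 'k" and j using that by blast
    \<comment> \<open>All three cases compose \<open>w\<close> with one further automorphism
      \<open>u\<close>; the signs multiply, and \<open>u\<close> may relabel the indices and change
      the component.\<close>
    have conclude: ?case
      if u: "autom u" "\<And>v :: real ^ 'n ^ 'k. (\<And>j. j \<notin> T \<Longrightarrow> v $ j = 0) \<Longrightarrow> u v = v"
        and \<sigma>': "inj_on \<sigma>' (insert o0 (insert c S))"
        and \<delta>: "\<delta> \<in> {1, - 1 :: real}"
        and us: "u s = \<delta> *\<^sub>R croot j (\<sigma>' o0) (\<sigma>' c)"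
        and uq: "\<And>q. q \<in> S \<Longrightarrow> u (croot i (\<sigma> o0) (\<sigma> q)) = \<delta> *\<^sub>R croot j (\<sigma>' o0) (\<sigma>' q)"
      for u \<delta> \<sigma>' j
    proof (intro exI conjI)
      show "autom (\<lambda>x. u (w x))" using u(1) w(1) by (rule autom_compose)
      show "\<forall>v :: real ^ 'n ^ 'k. (\<forall>j. j \<notin> T \<longrightarrow> v $ j = 0) \<longrightarrow> u (w v) = v"
        using u(2) w(2) by simp
      show "\<eta> * \<delta> \<in> {1, -1}" using \<eta> \<delta> by auto
      show "inj_on \<sigma>' (insert o0 (insert c S))" by fact
      show "\<forall>q\<in>insert c S. u (w (b q)) = (\<eta> * \<delta>) *\<^sub>R croot j (\<sigma>' o0) (\<sigma>' q)"
        using wb wbc us uq linear_scale[OF autom_linear[OF u(1)]] by auto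
    qed
    have co: "c \<noteq> o0" "c \<notin> S" "o0 \<notin> S" using insert by auto
    have vi: "v \<bullet> croot h a d = 0"
      if "\<And>j. j \<notin> T \<Longrightarrow> v $ j = 0" "s $ h \<noteq> 0" for v :: "real ^ 'n ^ 'k" and a d h
      using supp[OF that] by simp
    have vs: "v \<bullet> s = 0" if "\<And>j. j \<notin> T \<Longrightarrow> v $ j = 0" for v :: "real ^ 'n ^ 'k"
      using supp that by (intro inner_eq_0_if_disjoint_support) blast
    consider "S = {}" | q where "S = {q}" | "card S \<ge> 2"
    proof -
      assume *: "S = {} \<Longrightarrow> thesis" "\<And>q. S = {q} \<Longrightarrow> thesis" "2 \<le> card S \<Longrightarrow> thesis"
      have "card S = 0 \<or> card S = 1 \<or> 2 \<le> card S" by linarith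
      then show thesis using * by (auto simp: card_1_singleton_iff)
    qed
    then show ?case
    proof cases
      case 1
      have "s \<noteq> 0" using s(2) by auto
      then obtain j where j: "s $ j \<noteq> 0" by (auto simp: vec_eq_iff)
      obtain x y where xy: "s $ j $ x - s $ j $ y \<ge> 1"
        using exists_coord_diff_ge_one[OF s(1) j] by blast
      then have "x \<noteq> y" by auto
      have xy': "s \<bullet> croot j x y \<ge> 1" using xy by simp
      obtain u where u: "autom u" "u s = croot j x y"
        "\<And>v. v \<bullet> s = v \<bullet> croot j x y \<Longrightarrow> u v = v"
        using move_root[OF s(1) croot_mem s(2) inner_croot_self[OF \<open>x \<noteq> y\<close>] xy'] by metis
      show ?thesis
      proof (rule conclude[OF u(1), of "\<lambda>a. if a = o0 then x else y" 1 j])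
        fix v :: "real ^ 'n ^ 'k" assume "\<And>j. j \<notin> T \<Longrightarrow> v $ j = 0"
        then show "u v = v" using vi vs j by (intro u(3)) simp
      qed (use 1 u(2) co \<open>x \<noteq> y\<close> in \<open>auto simp: inj_on_def\<close>)
    next
      case (2 q)
      let ?A = "\<sigma> o0" and ?B = "\<sigma> q"
      have AB: "?A \<noteq> ?B" using \<sigma> co 2 by (auto simp: inj_on_def)
      have si: "s $ i \<noteq> 0" using sq[of q] 2 by auto
      have "card {?A, ?B} = 2" using AB by simp
      \<comment> \<open>Oddness provides an index outside the two used so far.\<close>
      then have "card {?A, ?B} \<noteq> CARD('n)" using pr(2) by (metis dvd_refl)
      then have "{?A, ?B} \<noteq> UNIV" by metis
      then obtain l where l: "l \<noteq> ?A" "l \<noteq> ?B" by blast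
      have d1: "s $ i $ ?A - s $ i $ ?B = 1" using sq[of q] 2 by simp
      \<comment> \<open>The two products are integers with sum 1, so at least one is
        positive.\<close>
      consider "s \<bullet> croot i ?A l \<ge> 1" | "s \<bullet> croot i l ?B \<ge> 1"
        using Ints_add_one_le[OF Ints_0 coord_diff_Ints[OF s(1)], of i ?A l] d1 by fastforce
      then show ?thesis
      proof cases
        case c1: 1
        obtain u where u: "autom u" "u s = croot i ?A l"
          "\<And>v. v \<bullet> s = v \<bullet> croot i ?A l \<Longrightarrow> u v = v"
          using move_root[OF s(1) croot_mem s(2) inner_croot_self c1] l(1) by metis
        have "u (croot i ?A ?B) = croot i ?A ?B"
          using l AB d1 by (intro u(3)) (simp add: inner_commute[of _ s] croot_nth_nth)
        then show ?thesis
          using u 2 co \<sigma> l vi[OF _ si] vs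
          by (intro conclude[OF u(1), of "\<sigma>(c := l)" 1 i]) (auto simp: inj_on_def)
      next
        case c2: 2
        obtain u where u: "autom u" "u s = croot i l ?B"
          "\<And>v. v \<bullet> s = v \<bullet> croot i l ?B \<Longrightarrow> u v = v"
          using move_root[OF s(1) croot_mem s(2) inner_croot_self c2] l(2) by metis
        have "u (croot i ?A ?B) = croot i ?A ?B"
          using l AB d1 by (intro u(3)) (simp add: inner_commute[of _ s] croot_nth_nth)
        \<comment> \<open>The two roots now share their negative end \<open>?B\<close>. Taking
          \<open>?B\<close> as the new centre, with \<open>q\<close> labelled by \<open>?A\<close>,
          turns them into a star again at the price of the sign -1.\<close>
        then show ?thesis
          using u 2 co \<sigma> l vi[OF _ si] vs
          by (intro conclude[OF u(1), of "\<sigma>(c := l, o0 := ?B, q := ?A)" "-1" i])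
            (auto simp: inj_on_def minus_croot)
      qed
    next
      case 3
      have inj: "inj_on \<sigma> S" using \<sigma> by (rule inj_on_subset) auto
      have N: "\<sigma> o0 \<notin> \<sigma> ` S" "card (\<sigma> ` S) \<ge> 2"
        using \<sigma> co 3 card_image[OF inj] by (auto simp: inj_on_def)
      have "insert (\<sigma> o0) (\<sigma> ` S) \<noteq> UNIV"
      proof
        assume "insert (\<sigma> o0) (\<sigma> ` S) = UNIV"
        then have "CARD('n) = card (\<sigma> ` insert o0 S)" by simp
        also have "\<dots> = card (insert o0 S)" using \<sigma> by (rule card_image)
        finally have "insert o0 S = UNIV" by (metis card_subset_eq finite subset_UNIV)
        then show False using co by auto
      qed
      from extend_star[OF pr s N this, of i] sq obtain u l where
        u: "autom u" "l \<notin> \<sigma> ` S" "l \<noteq> \<sigma> o0" "u s = croot i (\<sigma> o0) l"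
        "\<And>q. q \<in> S \<Longrightarrow> u (croot i (\<sigma> o0) (\<sigma> q)) = croot i (\<sigma> o0) (\<sigma> q)"
        "\<And>v :: real ^ 'n ^ 'k. (\<And>j. s $ j \<noteq> 0 \<Longrightarrow> v $ j = 0) \<Longrightarrow> u v = v"
        by (smt (verit) image_iff)
      show ?thesis
      proof (rule conclude[OF u(1), of "\<sigma>(c := l)" 1 i])
        fix v :: "real ^ 'n ^ 'k" assume "\<And>j. j \<notin> T \<Longrightarrow> v $ j = 0"
        then show "u v = v" using supp by (intro u(6)) blast
      next
        show "inj_on (\<sigma>(c := l)) (insert o0 (insert c S))"
          using \<sigma> u(2,3) co by (auto simp: inj_on_def)
      next
        show "u s = 1 *\<^sub>R croot i ((\<sigma>(c := l)) o0) ((\<sigma>(c := l)) c)" using u(4) co by simp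
      next
        fix q assume "q \<in> S"
        then show "u (croot i (\<sigma> o0) (\<sigma> q)) = 1 *\<^sub>R croot i ((\<sigma>(c := l)) o0) ((\<sigma>(c := l)) q)"
          using u(5) co by auto
      qed simp
    qed
  qed
qed

end

section \<open>Aligning the components under an isometry\<close>

definition lattice_iso :: "('a::real_inner \<Rightarrow> 'b::real_inner) \<Rightarrow> 'a set \<Rightarrow> 'b set \<Rightarrow> bool"
  where "lattice_iso f L M \<longleftrightarrow> bij_betw f L M \<and> (\<forall>x\<in>L. \<forall>y\<in>L. f (x + y) = f x + f y) \<and>
    (\<forall>x\<in>L. \<forall>y\<in>L. f x \<bullet> f y = x \<bullet> y)"

lemma lattice_isomorphic_iff: "lattice_isomorphic L M \<longleftrightarrow> (\<exists>f. lattice_iso f L M)"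
  by (simp add: lattice_isomorphic_def lattice_iso_def)

lemma lattice_iso_diff:
  assumes "framed_lattice L" "lattice_iso f L M" "x \<in> L" "y \<in> L"
  shows "f (x - y) = f x - f y"
proof -
  have "f (x - y + y) = f (x - y) + f y"
    using assms framed_lattice.diff_closed[OF assms(1)] unfolding lattice_iso_def by blast
  then show ?thesis by simp
qed

text \<open>Induction on the set \<open>T\<close> of components already aligned: the star of roots
  of the next component is moved into a single component by an automorphism that leaves the aligned
  images alone.\<close>

lemma align_components:
  fixes L M :: "(real ^ 'n ^ 'k) set"
  assumes L: "framed_lattice L" and M: "framed_lattice M"
    and pr: "prime CARD('n)" "odd CARD('n)" and f: "lattice_iso f L M"
  shows "\<exists>g \<tau> \<eta> \<sigma>. lattice_iso g L M \<and> inj_on \<tau> T \<and> (\<forall>j\<in>T. \<eta> j \<in> {1, -1} \<and> inj (\<sigma> j) \<and>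
    (\<forall>a b. g (croot j a b) = \<eta> j *\<^sub>R croot (\<tau> j) (\<sigma> j a) (\<sigma> j b)))"
proof -
  interpret L: framed_lattice L by fact
  interpret M: framed_lattice M by fact
  have "finite T" by simp
  then show ?thesis
  proof (induction T rule: finite_induct)
    case empty
    show ?case using f by auto
  next
    case (insert c T)
    then obtain g \<tau> \<eta> \<sigma> where g: "lattice_iso g L M" and \<tau>: "inj_on \<tau> T"
      and \<eta>: "\<And>j. j \<in> T \<Longrightarrow> \<eta> j \<in> {1, - 1 :: real}"
      and \<sigma>: "\<And>j. j \<in> T \<Longrightarrow> inj (\<sigma> j)"
      and gT: "\<And>j a b. j \<in> T \<Longrightarrow> g (croot j a b) = \<eta> j *\<^sub>R croot (\<tau> j) (\<sigma> j a) (\<sigma> j b)"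
      by blast
    have g_inner: "g x \<bullet> g y = x \<bullet> y" if "x \<in> L" "y \<in> L" for x y
      using g that by (simp add: lattice_iso_def)
    have g_mem: "g x \<in> M" if "x \<in> L" for x
      using g that by (auto simp: lattice_iso_def bij_betw_def)
    obtain o0 :: 'n where True by blast
    let ?b = "\<lambda>q. g (croot c o0 q)"
    have "?b q $ h = 0" if h: "h \<in> \<tau> ` T" for q h
    proof -
      obtain j where j: "j \<in> T" "h = \<tau> j" using h by blast
      \<comment> \<open>The images of the roots of component \<open>j\<close> are, up to sign, all
        roots of component \<open>\<tau> j\<close>, and \<open>?b q\<close> is orthogonal to them;
        hence its coordinates there are constant.\<close>
      have "?b q $ h $ a = ?b q $ h $ a'" for a a'
      proof -
        have "surj (\<sigma> j)" using \<sigma>[OF j(1)] by (simp add: finite_UNIV_inj_surj[OF finite])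
        then obtain d d' where d: "a = \<sigma> j d" "a' = \<sigma> j d'" by (meson surjD)
        have "j \<noteq> c" using insert.hyps(2) j(1) by blast
        then have "?b q \<bullet> g (croot j d d') = 0"
          by (subst g_inner) (auto simp: L.croot_mem)
        then show ?thesis using \<eta>[OF j(1)] unfolding gT[OF j(1)] d j(2) by auto
      qed
      then show ?thesis
        using M.balanced[OF g_mem[OF L.croot_mem]] by (intro coords_eq_0_if_constant_balanced)
    qed
    then have "\<exists>w i \<eta> \<sigma>. M.autom w \<and>
        (\<forall>v :: real ^ 'n ^ 'k. (\<forall>j. j \<notin> \<tau> ` T \<longrightarrow> v $ j = 0) \<longrightarrow> w v = v) \<and>
        \<eta> \<in> {1, -1} \<and> inj_on \<sigma> (insert o0 (UNIV - {o0})) \<and>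
        (\<forall>q\<in>UNIV - {o0}. w (?b q) = \<eta> *\<^sub>R croot i (\<sigma> o0) (\<sigma> q))"
      by (intro M.star_into_component[OF pr])
        (auto simp: g_inner L.croot_mem g_mem croot_nth_nth)
    then obtain w i \<zeta> \<rho> where w: "M.autom w"
        "\<And>v :: real ^ 'n ^ 'k. (\<And>j. j \<notin> \<tau> ` T \<Longrightarrow> v $ j = 0) \<Longrightarrow> w v = v"
      and \<zeta>: "\<zeta> \<in> {1, - 1 :: real}" and \<rho>: "inj_on \<rho> (insert o0 (UNIV - {o0}))"
      and wb: "\<And>q. q \<noteq> o0 \<Longrightarrow> w (?b q) = \<zeta> *\<^sub>R croot i (\<rho> o0) (\<rho> q)"
      by (auto simp: Ball_def)
    have \<rho>: "inj \<rho>" using \<rho> by (simp add: insert_absorb)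
    have g0: "g 0 = 0"
      using lattice_iso_diff[OF L g L.zero_mem L.zero_mem] by simp
    have w_lin: "linear w" using w(1) by (rule M.autom_linear)
    have wb': "w (?b q) = \<zeta> *\<^sub>R croot i (\<rho> o0) (\<rho> q)" for q
      using wb[of q] g0 linear_0[OF w_lin] by (cases "q = o0") auto
    have wc: "w (g (croot c a b)) = \<zeta> *\<^sub>R croot i (\<rho> a) (\<rho> b)" for a b
    proof -
      have "g (croot c a b) = ?b b - ?b a"
        using lattice_iso_diff[OF L g L.croot_mem L.croot_mem, of c o0 b c o0 a]
        by (simp add: croot_diff)
      then show ?thesis
        using wb' linear_diff[OF w_lin]
        by (simp add: scaleR_diff_right[symmetric] croot_diff)
    qed
    have wT: "w (g (croot j a b)) = g (croot j a b)" if "j \<in> T" for j a b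
    proof (rule w(2))
      fix h assume "h \<notin> \<tau> ` T"
      then have "h \<noteq> \<tau> j" using that by blast
      then show "g (croot j a b) $ h = 0" by (simp add: gT[OF that])
    qed
    \<comment> \<open>Otherwise some root from component \<open>c\<close> and some root from
      component \<open>j\<close> would have images equal up to sign, although the roots themselves
      are orthogonal.\<close>
    have "i \<notin> \<tau> ` T"
    proof
      assume "i \<in> \<tau> ` T"
      then obtain j where j: "j \<in> T" "i = \<tau> j" by blast
      obtain a b :: 'n where "a \<noteq> b"
      proof -
        have "CARD('n) \<noteq> 1" using pr(1) by auto
        then show ?thesis using that card_1_singleton_iff[of "UNIV :: 'n set"]
          by (metis UNIV_eq_I singletonI insert_iff One_nat_def)
      qed
      have "surj (\<sigma> j)" using \<sigma>[OF j(1)] by (simp add: finite_UNIV_inj_surj[OF finite])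
      then obtain d d' where d: "\<rho> a = \<sigma> j d" "\<rho> b = \<sigma> j d'" by (meson surjD)
      have ne: "\<rho> a \<noteq> \<rho> b" using \<rho> \<open>a \<noteq> b\<close> by (simp add: inj_eq)
      have "j \<noteq> c" using insert.hyps(2) j(1) by blast
      then have "w (g (croot c a b)) \<bullet> w (g (croot j d d')) = 0"
        by (subst M.autom_inner[OF w(1)], subst g_inner) (auto simp: L.croot_mem)
      then show False
        using \<zeta> \<eta>[OF j(1)] ne unfolding wc wT[OF j(1)] unfolding gT[OF j(1)] j(2) d
        by (auto simp: croot_nth_nth)
    qed
    show ?case
    proof (intro exI conjI)
      show "lattice_iso (\<lambda>x. w (g x)) L M"
        unfolding lattice_iso_def
      proof (intro conjI ballI)
        have "inj_on w M"
          using M.autom_def w(1) orthogonal_transformation_inj inj_on_subset by blast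
        then have "bij_betw w M M" using w(1) by (simp add: bij_betw_def M.autom_def)
        then show "bij_betw (\<lambda>x. w (g x)) L M"
          using g bij_betw_trans[of g L M w M] by (simp add: lattice_iso_def comp_def)
      next
        fix x y assume "x \<in> L" "y \<in> L"
        then show "w (g (x + y)) = w (g x) + w (g y)" "w (g x) \<bullet> w (g y) = x \<bullet> y"
          using g linear_add[OF w_lin] M.autom_inner[OF w(1)] by (auto simp: lattice_iso_def)
      qed
      show "inj_on (\<tau>(c := i)) (insert c T)"
        using \<tau> insert.hyps(2) \<open>i \<notin> \<tau> ` T\<close> by (auto simp: inj_on_def)
      show "\<forall>j\<in>insert c T. (\<eta>(c := \<zeta>)) j \<in> {1, -1} \<and> inj ((\<sigma>(c := \<rho>)) j) \<and>
        (\<forall>a b. w (g (croot j a b)) =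
          (\<eta>(c := \<zeta>)) j *\<^sub>R croot ((\<tau>(c := i)) j) ((\<sigma>(c := \<rho>)) j a) ((\<sigma>(c := \<rho>)) j b))"
        using \<zeta> \<eta> \<rho> \<sigma> wc wT gT insert.hyps(2) by auto
    qed
  qed
qed

text \<open>Products with the roots determine a balanced vector, so an isometry is known explicitly once
  its values on the roots are.\<close>

lemma lattice_iso_coords:
  fixes L M :: "(real ^ 'n ^ 'k) set"
  assumes L: "framed_lattice L" and M: "framed_lattice M" and g: "lattice_iso g L M"
    and \<eta>: "e \<in> {1, - 1 :: real}" and \<sigma>: "inj \<sigma>"
    and gc: "\<And>a b. g (croot j a b) = e *\<^sub>R croot h (\<sigma> a) (\<sigma> b)" and x: "x \<in> L"
  shows "g x $ h $ \<sigma> a = e * x $ j $ a"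
proof -
  interpret L: framed_lattice L by fact
  interpret M: framed_lattice M by fact
  \<comment> \<open>The error vector of the claimed formula: constant because \<open>g\<close>
    preserves products with roots, and balanced because \<open>\<sigma>\<close> is a bijection of
    the coordinates.\<close>
  define v where "v = (\<chi> a. g x $ h $ \<sigma> a - e * x $ j $ a)"
  have ee: "e * (e * u) = u" for u using \<eta> by auto
  have "v $ a = v $ b" for a b
  proof -
    have "g x \<bullet> g (croot j a b) = x \<bullet> croot j a b"
      using g x L.croot_mem unfolding lattice_iso_def by blast
    then have "e * (g x $ h $ \<sigma> a - g x $ h $ \<sigma> b) = x $ j $ a - x $ j $ b"
      unfolding gc by simp
    then have "g x $ h $ \<sigma> a - g x $ h $ \<sigma> b = e * (x $ j $ a - x $ j $ b)"
      using ee by metis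
    then show ?thesis by (simp add: v_def algebra_simps)
  qed
  moreover have "(\<Sum>a\<in>UNIV. v $ a) = 0"
  proof -
    have "g x \<in> M" using g x by (auto simp: lattice_iso_def bij_betw_def)
    moreover have "bij \<sigma>" using \<sigma> by (simp add: bij_def finite_UNIV_inj_surj[OF finite])
    then have "(\<Sum>a\<in>UNIV. g x $ h $ \<sigma> a) = (\<Sum>a\<in>UNIV. g x $ h $ a)"
      by (rule sum.reindex_bij_betw)
    ultimately show ?thesis
      using M.balanced L.balanced[OF x] by (simp add: v_def sum_subtractf sum_distrib_left[symmetric])
  qed
  ultimately have "v = 0" by (rule coords_eq_0_if_constant_balanced)
  then have "v $ a = 0" by simp
  then show ?thesis by (simp add: v_def)
qed

section \<open>Signed permutations\<close>

lemma mult_BijGroup_UNIV: "bij f \<Longrightarrow> bij g \<Longrightarrow> f \<otimes>\<^bsub>BijGroup UNIV\<^esub> g = f \<circ> g"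
  by (auto simp: BijGroup_def Bij_def compose_def comp_def)

lemma signed_perms_compose:
  "f \<in> signed_perms \<Longrightarrow> g \<in> signed_perms \<Longrightarrow> bij f \<Longrightarrow> bij g \<Longrightarrow> f \<circ> g \<in> signed_perms"
  using generate.eng[of f "BijGroup UNIV" _ g]
  by (simp add: signed_perms_def mult_BijGroup_UNIV)

text \<open>A normal form for the elements of the group generated by coordinate permutations and
  sign changes.\<close>

definition signed_perm :: "('k \<Rightarrow> 'a::comm_ring_1) \<Rightarrow> ('k \<Rightarrow> 'k) \<Rightarrow> 'a ^ 'k \<Rightarrow> 'a ^ 'k"
  where "signed_perm e s x = (\<chi> i. e i * x $ s i)"

lemma signed_perm_compose:
  "signed_perm e s \<circ> signed_perm e' s' = signed_perm (\<lambda>i. e i * e' (s i)) (s' \<circ> s)"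
  by (auto simp: fun_eq_iff vec_eq_iff signed_perm_def mult.assoc)

lemma signed_perm_inverse:
  fixes e :: "'k::finite \<Rightarrow> 'a::comm_ring_1"
  assumes "s permutes UNIV" "\<And>i. e i \<in> {1, - 1}"
  shows "signed_perm (\<lambda>i. e (inv_into UNIV s i)) (inv_into UNIV s) \<circ> signed_perm e s = id"
    and "signed_perm e s \<circ> signed_perm (\<lambda>i. e (inv_into UNIV s i)) (inv_into UNIV s) = id"
proof -
  have e: "e i * e i = 1" for i using assms(2)[of i] by auto
  show "signed_perm (\<lambda>i. e (inv_into UNIV s i)) (inv_into UNIV s) \<circ> signed_perm e s = id"
    "signed_perm e s \<circ> signed_perm (\<lambda>i. e (inv_into UNIV s i)) (inv_into UNIV s) = id"
    unfolding signed_perm_compose using e permutes_inverses[OF assms(1)]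
    by (auto simp: signed_perm_def fun_eq_iff vec_eq_iff)
qed

lemma bij_signed_perm:
  fixes e :: "'k::finite \<Rightarrow> 'a::comm_ring_1"
  assumes "s permutes UNIV" "\<And>i. e i \<in> {1, - 1}"
  shows "bij (signed_perm e s)"
  using signed_perm_inverse[OF assms] by (rule o_bij)

lemma coord_perm_eq_signed_perm: "coord_perm s = signed_perm (\<lambda>_. 1) s"
  by (simp add: fun_eq_iff vec_eq_iff coord_perm_def signed_perm_def)

lemma coord_neg_eq_signed_perm: "coord_neg i = signed_perm (\<lambda>j. if j = i then - 1 else 1) id"
  by (simp add: fun_eq_iff vec_eq_iff coord_neg_def signed_perm_def)

text \<open>Signed permutations contain the generators and are closed under composition and inverse.
  Conversely, each is a product of single sign changes and one coordinate permutation.\<close>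

lemma signed_perms_eq:
  "(signed_perms :: ('a::comm_ring_1 ^ 'k::finite \<Rightarrow> 'a ^ 'k) set) =
    {signed_perm e s | e s. s permutes UNIV \<and> (\<forall>i. e i \<in> {1, - 1})}" (is "_ = ?R")
proof
  let ?H = "{coord_perm s | s. s permutes UNIV} \<union> range coord_neg :: ('a ^ 'k \<Rightarrow> 'a ^ 'k) set"
  have bijR: "bij f" if "f \<in> ?R" for f using that bij_signed_perm by auto
  have HR: "?H \<subseteq> ?R"
    using permutes_id by (fastforce simp: coord_perm_eq_signed_perm coord_neg_eq_signed_perm)
  show "signed_perms \<subseteq> ?R"
  proof
    fix f :: "'a ^ 'k \<Rightarrow> 'a ^ 'k"
    assume "f \<in> signed_perms"
    then show "f \<in> ?R" unfolding signed_perms_def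
    proof (induction rule: generate.induct)
      case one
      have "\<one>\<^bsub>BijGroup UNIV\<^esub> = (signed_perm (\<lambda>_. 1) id :: 'a ^ 'k \<Rightarrow> 'a ^ 'k)"
        by (simp add: BijGroup_def fun_eq_iff vec_eq_iff signed_perm_def)
      then show ?case using permutes_id by blast
    next
      case (incl h)
      then show ?case using HR by blast
    next
      case (inv h)
      then have "h \<in> ?R" using HR by blast
      then obtain e s where h: "h = signed_perm e s" "s permutes UNIV" "\<And>i. e i \<in> {1, - 1}"
        by blast
      have "inv\<^bsub>BijGroup UNIV\<^esub> h = (\<lambda>x\<in>UNIV. inv_into UNIV h x)"
        using bij_signed_perm[OF h(2,3)] h(1) by (intro inv_BijGroup) (auto simp: Bij_def)
      also have "\<dots> = inv_into UNIV h" by (simp add: restrict_def)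
      also have "\<dots> = signed_perm (\<lambda>i. e (inv_into UNIV s i)) (inv_into UNIV s)"
        unfolding h(1) by (intro inv_unique_comp signed_perm_inverse h(2,3))
      finally show ?case using permutes_inv[OF h(2)] h(3) by blast
    next
      case (eng f g)
      then obtain e s e' s' where fg: "f = signed_perm e s" "s permutes UNIV" "\<And>i. e i \<in> {1, - 1}"
        "g = signed_perm e' s'" "s' permutes UNIV" "\<And>i. e' i \<in> {1, - 1}" by blast
      have "f \<otimes>\<^bsub>BijGroup UNIV\<^esub> g = f \<circ> g"
        using eng.IH[THEN bijR] by (rule mult_BijGroup_UNIV)
      also have "\<dots> = signed_perm (\<lambda>i. e i * e' (s i)) (s' \<circ> s)"
        unfolding fg by (rule signed_perm_compose)
      finally have "f \<otimes>\<^bsub>BijGroup UNIV\<^esub> g = signed_perm (\<lambda>i. e i * e' (s i)) (s' \<circ> s)" .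
      moreover have "s' \<circ> s permutes UNIV" using fg(2,5) by (rule permutes_compose)
      moreover have "e i * e' (s i) \<in> {1, - 1}" for i using fg(3)[of i] fg(6)[of "s i"] by auto
      ultimately show ?case by blast
    qed
  qed
  show "?R \<subseteq> signed_perms"
  proof
    fix f assume "f \<in> ?R"
    then obtain e s where f: "f = signed_perm e s" "s permutes UNIV" "\<And>i. e i \<in> {1, - 1}" by blast
    \<comment> \<open>Sign change on the whole set \<open>S\<close>, obtained below by adding one
      coordinate at a time.\<close>
    define N where "N = (\<lambda>S. signed_perm (\<lambda>i. if i \<in> S then - 1 else 1) id :: 'a ^ 'k \<Rightarrow> 'a ^ 'k)"
    have bijN: "bij (N S)" for S
      unfolding N_def by (rule bij_signed_perm) (auto simp: permutes_id)
    have N: "N S \<in> signed_perms" for S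
    proof -
      have "finite S" by simp
      then show ?thesis
      proof (induction S rule: finite_induct)
        case empty
        have "N {} = coord_perm id" by (simp add: N_def coord_perm_eq_signed_perm)
        then show ?case unfolding signed_perms_def using permutes_id by (intro generate.incl) blast
      next
        case (insert c S)
        have "N (insert c S) = N S \<circ> coord_neg c"
          using insert.hyps unfolding N_def coord_neg_eq_signed_perm signed_perm_compose
          by (intro arg_cong2[of _ _ _ _ signed_perm]) auto
        moreover have "coord_neg c \<in> (signed_perms :: ('a ^ 'k \<Rightarrow> 'a ^ 'k) set)"
          unfolding signed_perms_def by (intro generate.incl) auto
        moreover have "bij (coord_neg c :: 'a ^ 'k \<Rightarrow> 'a ^ 'k)"
          using HR by (intro bijR) blast
        ultimately show ?case
          using insert.IH bijN by (simp only: signed_perms_compose)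
      qed
    qed
    have "e = (\<lambda>i. if i \<in> {i. e i = - 1} then - 1 else 1)"
      using f(3) by (auto simp: fun_eq_iff)
    then have "f = N {i. e i = - 1} \<circ> coord_perm s"
      unfolding f(1) N_def coord_perm_eq_signed_perm signed_perm_compose by simp
    moreover have "coord_perm s \<in> (signed_perms :: ('a ^ 'k \<Rightarrow> 'a ^ 'k) set)"
      unfolding signed_perms_def using f(2) by (intro generate.incl) blast
    moreover have "bij (coord_perm s :: 'a ^ 'k \<Rightarrow> 'a ^ 'k)"
      using HR f(2) by (intro bijR) blast
    ultimately show "f \<in> signed_perms"
      using N bijN by (simp only: signed_perms_compose)
  qed
qed

section \<open>Construction A\<close>

text \<open>The coset of \<open>c\<close> times \<open>eps 1\<close> modulo the root lattice, in a
  form symmetric in the coordinates: every coordinate of \<open>eps 1\<close> is congruent to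
  \<open>- 1 / p\<close> modulo 1.\<close>

definition in_glue_coset :: "'p::prime_card mod_ring \<Rightarrow> real ^ 'p mod_ring \<Rightarrow> bool"
  where "in_glue_coset c v \<longleftrightarrow> (\<Sum>a\<in>UNIV. v $ a) = 0 \<and>
    (\<forall>a. v $ a + of_int (to_int_mod_ring c) / real CARD('p) \<in> \<int>)"

lemma of_int_to_int_mod_ring [simp]: "of_int (to_int_mod_ring c) = (c :: 'p::prime_card mod_ring)"
  by (simp add: of_int_of_int_mod_ring)

lemma of_int_div_card_Ints_iff:
  "of_int z / real CARD('p) \<in> \<int> \<longleftrightarrow> of_int z = (0 :: 'p::prime_card mod_ring)"
proof -
  have "of_int z = (0 :: 'p mod_ring) \<longleftrightarrow> int CARD('p) dvd z"
    using of_int_eq_0_iff_char_dvd[where 'a = "'p mod_ring", of z] by simp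
  moreover have "of_int z / real CARD('p) \<in> \<int> \<longleftrightarrow> int CARD('p) dvd z"
  proof
    assume "of_int z / real CARD('p) \<in> \<int>"
    then obtain k where "of_int z / real CARD('p) = of_int k" by (auto elim: Ints_cases)
    then have "real_of_int z = real_of_int (int CARD('p) * k)" by (simp add: field_simps)
    then have "z = int CARD('p) * k" by (simp only: of_int_eq_iff)
    then show "int CARD('p) dvd z" by simp
  qed (auto elim!: dvdE)
  ultimately show ?thesis by simp
qed

text \<open>Two integers representing \<open>c\<close> differ by a multiple of \<open>p\<close>, so
  the fraction changes by an integer. Later arguments may thus use any representative.\<close>

lemma in_glue_coset_iff:
  fixes c :: "'p::prime_card mod_ring"
  assumes "of_int n = c"
  shows "in_glue_coset c v \<longleftrightarrow> (\<Sum>a\<in>UNIV. v $ a) = 0 \<and> (\<forall>a. v $ a + of_int n / real CARD('p) \<in> \<int>)"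
proof -
  have "of_int (n - to_int_mod_ring c) = (0 :: 'p mod_ring)" using assms by simp
  then have *: "of_int (n - to_int_mod_ring c) / real CARD('p) \<in> \<int>"
    by (simp only: of_int_div_card_Ints_iff)
  have "y + of_int n / real CARD('p) \<in> \<int> \<longleftrightarrow> y + of_int (to_int_mod_ring c) / real CARD('p) \<in> \<int>" for y :: real
  proof -
    have "y + of_int n / real CARD('p) = (y + of_int (to_int_mod_ring c) / real CARD('p))
        + of_int (n - to_int_mod_ring c) / real CARD('p)"
      by (simp add: diff_divide_distrib)
    then show ?thesis using * add_in_Ints_iff_right by metis
  qed
  then show ?thesis by (simp add: in_glue_coset_def)
qed

lemma in_glue_coset_diff:
  assumes "in_glue_coset c v" "in_glue_coset d w"
  shows "in_glue_coset (c - d) (v - w)"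
proof (subst in_glue_coset_iff[of "to_int_mod_ring c - to_int_mod_ring d"], goal_cases)
  case 2
  have "v $ a - w $ a + of_int (to_int_mod_ring c - to_int_mod_ring d) / real CARD('a) =
    (v $ a + of_int (to_int_mod_ring c) / real CARD('a)) -
    (w $ a + of_int (to_int_mod_ring d) / real CARD('a))" for a
    by (simp add: diff_divide_distrib)
  moreover have "(v $ a + of_int (to_int_mod_ring c) / real CARD('a)) -
    (w $ a + of_int (to_int_mod_ring d) / real CARD('a)) \<in> \<int>" for a
    using assms unfolding in_glue_coset_def by (intro Ints_diff) auto
  ultimately have "v $ a - w $ a + of_int (to_int_mod_ring c - to_int_mod_ring d) / real CARD('a) \<in> \<int>" for a
    by (simp only:)
  then show ?case
    using assms by (simp add: in_glue_coset_def sum_subtractf)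
qed simp

lemma in_glue_coset_uminus: "in_glue_coset c v \<Longrightarrow> in_glue_coset (- c) (- v)"
  using in_glue_coset_diff[of 0 0 c v] by (simp add: in_glue_coset_iff[of 0 0])

lemma in_glue_coset_unique:
  fixes c d :: "'p::prime_card mod_ring"
  assumes "in_glue_coset c v" "in_glue_coset d v"
  shows "c = d"
proof -
  have "in_glue_coset (c - d) 0" using in_glue_coset_diff[OF assms] by simp
  then have "of_int (to_int_mod_ring (c - d)) / real CARD('p) \<in> \<int>"
    by (simp add: in_glue_coset_def)
  then show ?thesis by (simp add: of_int_div_card_Ints_iff)
qed

text \<open>Permuting the coordinates inside a component acts trivially on the quotient of the dual
  by the root lattice; only signs will survive there.\<close>

lemma in_glue_coset_reindex:
  assumes "in_glue_coset c v" "bij \<sigma>" "\<And>a. w $ \<sigma> a = v $ a"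
  shows "in_glue_coset c w"
proof -
  have "(\<Sum>a\<in>UNIV. w $ a) = (\<Sum>a\<in>UNIV. w $ \<sigma> a)"
    using sum.reindex_bij_betw[OF assms(2), of "\<lambda>a. w $ a"] by simp
  moreover have "\<exists>b. w $ a = v $ b" for a
    using assms(2,3) by (metis bij_def surjD)
  ultimately show ?thesis
    using assms(1,3) unfolding in_glue_coset_def by (metis (no_types, lifting) sum.cong)
qed

section \<open>Glue vectors, the dual root lattice and Construction A\<close>

lemma eps_nth: "eps i $ a = (if a = i then 1 else 0) - 1 / real CARD('n)" for i a :: "'n::finite"
proof -
  have "(\<Sum>j\<in>UNIV. axis j (1::real) $ a) = (\<Sum>j\<in>UNIV. if j = a then 1 else 0)"
    by (intro sum.cong) (auto simp: axis_def)
  then show ?thesis by (simp add: eps_def axis_def)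
qed

lemma sum_eps: "(\<Sum>a\<in>UNIV. eps i $ a) = 0"
  by (simp add: eps_nth sum_subtractf)

lemma diff_glue_mem_A_lattice_iff:
  "v - of_int (to_int_mod_ring c) *\<^sub>R eps 1 \<in> A_lattice \<longleftrightarrow> in_glue_coset c v"
proof -
  have "v $ a - of_int (to_int_mod_ring c) * eps 1 $ a \<in> \<int> \<longleftrightarrow>
      v $ a + of_int (to_int_mod_ring c) / real CARD('a) \<in> \<int>" for a
  proof -
    have "v $ a - of_int (to_int_mod_ring c) * eps 1 $ a =
      (v $ a + of_int (to_int_mod_ring c) / real CARD('a)) +
        of_int (if a = 1 then - to_int_mod_ring c else 0)"
      by (simp add: eps_nth algebra_simps)
    then show ?thesis using add_in_Ints_iff_right[OF Ints_of_int] by metis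
  qed
  then show ?thesis
    by (simp add: A_lattice_def in_glue_coset_def sum_subtractf sum_distrib_left[symmetric] sum_eps conj_commute)
qed

lemma in_glue_coset_eps: "in_glue_coset c (of_int (to_int_mod_ring c) *\<^sub>R eps 1)"
  unfolding diff_glue_mem_A_lattice_iff[symmetric] by (simp add: A_lattice_def)

lemma A_lattice_diff: "x \<in> A_lattice \<Longrightarrow> y \<in> A_lattice \<Longrightarrow> x - y \<in> A_lattice"
  by (simp add: A_lattice_def sum_subtractf)

lemma A_lattice_add: "x \<in> A_lattice \<Longrightarrow> y \<in> A_lattice \<Longrightarrow> x + y \<in> A_lattice"
  by (simp add: A_lattice_def sum.distrib)

lemma A_coset_eq_iff: "A_coset v = A_coset w \<longleftrightarrow> v - w \<in> A_lattice"
proof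
  assume "A_coset v = A_coset w"
  moreover have "v \<in> A_coset v"
    unfolding A_coset_def by (rule image_eqI[of _ _ 0]) (auto simp: A_lattice_def)
  ultimately obtain a where "v = w + a" "a \<in> A_lattice" by (auto simp: A_coset_def)
  then show "v - w \<in> A_lattice" by simp
next
  assume *: "v - w \<in> A_lattice"
  have "v + a = w + ((v - w) + a)" "w + a = v + (a - (v - w))" for a by simp_all
  then show "A_coset v = A_coset w"
    unfolding A_coset_def using * A_lattice_add A_lattice_diff by blast
qed

text \<open>A multiple of \<open>eps i\<close> lies in the root lattice, so \<open>eps i\<close> is
  in its span; and a balanced \<open>x\<close> has product \<open>x $ i\<close> with
  \<open>eps i\<close>.\<close>

lemma eps_mem_dual_A_lattice: "eps i \<in> dual_lattice A_lattice" for i :: "'n::finite"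
proof -
  let ?p = "real CARD('n)"
  have "(?p *\<^sub>R eps i) $ a \<in> \<int>" for a by (simp add: eps_nth right_diff_distrib)
  moreover have "(\<Sum>a\<in>UNIV. (?p *\<^sub>R eps i) $ a) = 0"
    by (simp add: sum_distrib_left[symmetric] sum_eps)
  ultimately have "?p *\<^sub>R eps i \<in> A_lattice" by (simp add: A_lattice_def)
  then have "(1 / ?p) *\<^sub>R (?p *\<^sub>R eps i) \<in> span A_lattice"
    by (intro span_scale span_base)
  moreover have "x \<bullet> eps i \<in> \<int>" if "x \<in> A_lattice" for x
  proof -
    have "x \<bullet> eps i = (\<Sum>a\<in>UNIV. (if a = i then x $ i else 0) - x $ a * (1 / ?p))"
      unfolding inner_vec_def by (intro sum.cong) (auto simp: eps_nth right_diff_distrib)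
    also have "\<dots> = x $ i - (\<Sum>a\<in>UNIV. x $ a) * (1 / ?p)"
      by (simp only: sum_subtractf sum_distrib_right) simp
    finally show ?thesis using that by (simp add: A_lattice_def)
  qed
  ultimately show ?thesis by (simp add: dual_lattice_def)
qed

lemma A_lattice_subset_dual: "A_lattice \<subseteq> dual_lattice A_lattice"
  by (auto simp: dual_lattice_def A_lattice_def inner_vec_def intro!: span_base)

lemma in_glue_coset_imp_dual:
  assumes "in_glue_coset c v"
  shows "v \<in> dual_lattice A_lattice"
proof -
  let ?n = "of_int (to_int_mod_ring c) :: real"
  have d: "v - ?n *\<^sub>R eps 1 \<in> dual_lattice A_lattice"
    using assms A_lattice_subset_dual by (auto simp: diff_glue_mem_A_lattice_iff[symmetric])
  have "(v - ?n *\<^sub>R eps 1) + ?n *\<^sub>R eps 1 \<in> dual_lattice A_lattice"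
    using d eps_mem_dual_A_lattice[of "1 :: 'a mod_ring"]
    unfolding dual_lattice_def mem_Collect_eq inner_add_right inner_scaleR_right
    by (blast intro: span_add span_scale Ints_add Ints_mult Ints_of_int)
  then show ?thesis by simp
qed

lemma mem_construction_A_iff:
  "x \<in> construction_A C \<longleftrightarrow> (\<exists>c\<in>C. \<forall>j. in_glue_coset (c $ j) (x $ j))"
proof -
  have "glue_proj x = glue_embed c \<longleftrightarrow> (\<forall>j. in_glue_coset (c $ j) (x $ j))" for c
    by (simp add: vec_eq_iff glue_proj_def glue_embed_def A_coset_eq_iff diff_glue_mem_A_lattice_iff)
  then show ?thesis
    unfolding construction_A_def image_iff by (auto dest: in_glue_coset_imp_dual)
qed

text \<open>Adding the fractions makes all coordinates integral. In the expanded product the mixed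
  terms vanish by balance, and the \<open>p\<close> constant terms add up to the stated
  fraction.\<close>

lemma inner_in_glue_cosets:
  fixes c d :: "'p::prime_card mod_ring"
  assumes "in_glue_coset c v" "in_glue_coset d w"
  shows "v \<bullet> w + of_int (to_int_mod_ring c * to_int_mod_ring d) / real CARD('p) \<in> \<int>"
proof -
  let ?p = "real CARD('p)"
  define m n where "m = real_of_int (to_int_mod_ring c)" and "n = real_of_int (to_int_mod_ring d)"
  have "(\<Sum>a\<in>UNIV. (v $ a + m / ?p) * (w $ a + n / ?p)) =
      (\<Sum>a\<in>UNIV. v $ a * w $ a + n / ?p * v $ a + m / ?p * w $ a + (m / ?p) * (n / ?p))"
    by (intro sum.cong) (auto simp: algebra_simps)
  also have "\<dots> = v \<bullet> w + n / ?p * (\<Sum>a\<in>UNIV. v $ a) + m / ?p * (\<Sum>a\<in>UNIV. w $ a) + ?p * (m / ?p * (n / ?p))"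
    by (simp only: sum.distrib sum_distrib_left inner_vec_def inner_real_def) simp
  also have "\<dots> = v \<bullet> w + m * n / ?p"
    using assms by (simp add: in_glue_coset_def)
  finally have "v \<bullet> w + m * n / ?p = (\<Sum>a\<in>UNIV. (v $ a + m / ?p) * (w $ a + n / ?p))" ..
  also have "\<dots> \<in> \<int>"
    using assms unfolding in_glue_coset_def m_def n_def by (intro Ints_sum Ints_mult) auto
  finally show ?thesis by (simp add: m_def n_def)
qed

text \<open>Modulo 1 the inner product of two lattice vectors is \<open>- 1 / p\<close> times the
  dot product of their codewords, which self-orthogonality makes divisible by
  \<open>p\<close>.\<close>

lemma framed_lattice_construction_A:
  fixes C :: "('p::prime_card mod_ring ^ 'k) set"
  assumes "vec.subspace C" "self_orthogonal C"
  shows "framed_lattice (construction_A C)"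
proof
  fix x y :: "real ^ 'p mod_ring ^ 'k"
  assume "x \<in> construction_A C" "y \<in> construction_A C"
  then obtain c d where c: "c \<in> C" "\<And>j. in_glue_coset (c $ j) (x $ j)"
    and d: "d \<in> C" "\<And>j. in_glue_coset (d $ j) (y $ j)"
    by (auto simp: mem_construction_A_iff)
  have "c - d \<in> C" using assms(1) c(1) d(1) by (rule vec.subspace_diff)
  then show "x - y \<in> construction_A C"
    using c(2) d(2) by (auto simp: mem_construction_A_iff intro!: bexI[of _ "c - d"] in_glue_coset_diff)
  let ?z = "\<lambda>j. to_int_mod_ring (c $ j) * to_int_mod_ring (d $ j)"
  have "of_int (\<Sum>j\<in>UNIV. ?z j) = code_dot c d"
    by (simp add: code_dot_def)
  also have "\<dots> = 0"
    using assms(2) c(1) d(1) by (auto simp: self_orthogonal_def dual_code_def)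
  finally have "of_int (\<Sum>j\<in>UNIV. ?z j) / real CARD('p) \<in> \<int>"
    by (simp only: of_int_div_card_Ints_iff)
  moreover have "(\<Sum>j\<in>UNIV. x $ j \<bullet> y $ j + of_int (?z j) / real CARD('p)) \<in> \<int>"
    using inner_in_glue_cosets[OF c(2) d(2)] by (intro Ints_sum)
  moreover have "(\<Sum>j\<in>UNIV. x $ j \<bullet> y $ j + of_int (?z j) / real CARD('p)) =
      x \<bullet> y + of_int (\<Sum>j\<in>UNIV. ?z j) / real CARD('p)"
    by (simp only: sum.distrib inner_vec_def[of x y] of_int_sum sum_divide_distrib)
  ultimately show "x \<bullet> y \<in> \<int>" by (metis add_in_Ints_iff_right)
next
  fix x :: "real ^ 'p mod_ring ^ 'k" and i
  assume "x \<in> construction_A C"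
  then show "(\<Sum>a\<in>UNIV. x $ i $ a) = 0"
    by (auto simp: mem_construction_A_iff in_glue_coset_def)
next
  fix i :: 'k and a b :: "'p mod_ring"
  have "in_glue_coset 0 (croot i a b $ j)" for j
    by (cases "j = i")
      (auto simp: in_glue_coset_iff[of 0 0] croot_nth_nth sum_subtractf)
  then show "croot i a b \<in> construction_A C"
    using vec.subspace_0[OF assms(1)] by (auto simp: mem_construction_A_iff intro!: bexI[of _ 0])
qed

section \<open>Passing between isometries and code isomorphisms\<close>

lemma exists_lattice_point_over:
  fixes c :: "'p::prime_card mod_ring ^ 'k"
  obtains x :: "real ^ 'p mod_ring ^ 'k" where "\<And>j. in_glue_coset (c $ j) (x $ j)"
  by (rule that[of "\<chi> j. of_int (to_int_mod_ring (c $ j)) *\<^sub>R eps 1"])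
    (simp add: in_glue_coset_eps)

text \<open>The conditional carries the sign from the reals to the field.\<close>

lemma in_glue_coset_signed:
  assumes "in_glue_coset c v" "e \<in> {1, - 1 :: real}"
  shows "in_glue_coset ((if e = 1 then 1 else - 1) * c) (e *\<^sub>R v)"
  using assms in_glue_coset_uminus by auto

lemma code_isomorphic_if_lattice_isomorphic:
  fixes C D :: "('p::prime_card mod_ring ^ 'k) set"
  assumes "odd CARD('p)"
    and "vec.subspace C" "self_orthogonal C" "vec.subspace D" "self_orthogonal D"
    and "lattice_isomorphic (construction_A C) (construction_A D)"
  shows "code_isomorphic C D"
proof -
  let ?L = "construction_A C" and ?M = "construction_A D"
  have L: "framed_lattice ?L" and M: "framed_lattice ?M"
    using assms by (auto intro: framed_lattice_construction_A)
  have pr: "prime CARD('p mod_ring)" "odd CARD('p mod_ring)"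
    using assms(1) prime_card[where 'a = 'p] by auto
  obtain f where f: "lattice_iso f ?L ?M" using assms(6) by (auto simp: lattice_isomorphic_iff)
  obtain g \<tau> \<eta> \<sigma> where g: "lattice_iso g ?L ?M" and \<tau>: "inj \<tau>"
    and \<eta>: "\<And>j. \<eta> j \<in> {1, - 1 :: real}" and \<sigma>: "\<And>j. inj (\<sigma> j)"
    and gc: "\<And>j a b. g (croot j a b) = \<eta> j *\<^sub>R croot (\<tau> j) (\<sigma> j a) (\<sigma> j b)"
    using align_components[OF L M pr f, of UNIV] by blast
  have surj: "surj \<tau>" using \<tau> by (rule finite_UNIV_inj_surj[OF finite])
  have g_img: "g ` ?L = ?M" using g by (simp add: lattice_iso_def bij_betw_def)
  \<comment> \<open>The inverse appears because \<open>signed_perm\<close> reads its argument at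
    \<open>s h\<close>, while \<open>\<tau>\<close> sends components of the source to components of
    the target.\<close>
  define s where "s = inv_into UNIV \<tau>"
  have s\<tau>: "s (\<tau> j) = j" "\<tau> (s h) = h" for j h
    using \<tau> surj by (simp_all add: s_def surj_f_inv_f)
  define e :: "'k \<Rightarrow> 'p mod_ring" where "e = (\<lambda>h. if \<eta> (s h) = 1 then 1 else - 1)"
  have s: "s permutes UNIV"
    unfolding permutes_def using s\<tau> by (metis UNIV_I)
  have cls: "in_glue_coset (signed_perm e s c $ h) (g x $ h)"
    if x: "x \<in> ?L" and c: "\<And>j. in_glue_coset (c $ j) (x $ j)" for x c h
  proof -
    have "bij (\<sigma> (s h))" using \<sigma> by (simp add: bij_def finite_UNIV_inj_surj[OF finite])
    moreover have "in_glue_coset (e h * c $ s h) (\<eta> (s h) *\<^sub>R x $ s h)"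
      unfolding e_def by (rule in_glue_coset_signed[OF c \<eta>])
    moreover have "g x $ h $ \<sigma> (s h) a = (\<eta> (s h) *\<^sub>R x $ s h) $ a" for a
      using lattice_iso_coords[OF L M g \<eta> \<sigma> gc x, of "s h" a] s\<tau> by simp
    ultimately show ?thesis
      unfolding signed_perm_def by (auto intro: in_glue_coset_reindex)
  qed
  have eq: "d = signed_perm e s c"
    if "x \<in> ?L" "\<And>j. in_glue_coset (c $ j) (x $ j)" "\<And>j. in_glue_coset (d $ j) (g x $ j)" for x c d
    using cls[OF that(1,2)] that(3) in_glue_coset_unique by (metis vec_eq_iff)
  \<comment> \<open>Every codeword is the class of some lattice vector, so both inclusions follow
    from \<open>g\<close> mapping one lattice onto the other.\<close>
  have "signed_perm e s ` C = D"
  proof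
    show "signed_perm e s ` C \<subseteq> D"
    proof
      fix d assume "d \<in> signed_perm e s ` C"
      then obtain c where c: "c \<in> C" "d = signed_perm e s c" by blast
      obtain x where x: "\<And>j. in_glue_coset (c $ j) (x $ j)" using exists_lattice_point_over by blast
      then have "x \<in> ?L" using c(1) by (auto simp: mem_construction_A_iff)
      moreover from this have "g x \<in> ?M" using g_img by blast
      then obtain d' where "d' \<in> D" "\<And>j. in_glue_coset (d' $ j) (g x $ j)"
        by (auto simp: mem_construction_A_iff)
      ultimately show "d \<in> D" using eq x c(2) by metis
    qed
    show "D \<subseteq> signed_perm e s ` C"
    proof
      fix d assume d: "d \<in> D"
      obtain y where y: "\<And>j. in_glue_coset (d $ j) (y $ j)" using exists_lattice_point_over by blast
      then have "y \<in> ?M" using d by (auto simp: mem_construction_A_iff)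
      then obtain x where x: "x \<in> ?L" "y = g x" using g_img by blast
      then obtain c where "c \<in> C" "\<And>j. in_glue_coset (c $ j) (x $ j)"
        by (auto simp: mem_construction_A_iff)
      then show "d \<in> signed_perm e s ` C" using eq x y by blast
    qed
  qed
  moreover have "e i \<in> {1, - 1}" for i by (simp add: e_def)
  then have "signed_perm e s \<in> signed_perms"
    unfolding signed_perms_eq using s by blast
  ultimately show ?thesis unfolding code_isomorphic_def by blast
qed

text \<open>The code map lifts by permuting whole components and applying the signs as real scalars,
  which is an isometry compatible with the cosets.\<close>

lemma lattice_isomorphic_if_code_isomorphic:
  fixes C D :: "('p::prime_card mod_ring ^ 'k) set"
  assumes "code_isomorphic C D"
  shows "lattice_isomorphic (construction_A C) (construction_A D)"
proof -
  obtain e :: "'k \<Rightarrow> 'p mod_ring" and s where s: "s permutes UNIV" and e: "\<And>i. e i \<in> {1, - 1}"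
    and D: "D = signed_perm e s ` C"
    using assms unfolding code_isomorphic_def signed_perms_eq by blast
  define \<eta> :: "'k \<Rightarrow> real" where "\<eta> = (\<lambda>i. if e i = 1 then 1 else - 1)"
  have \<eta>: "\<eta> i * \<eta> i = 1" "\<eta> i \<in> {1, - 1}" for i by (auto simp: \<eta>_def)
  have e_eq: "(if \<eta> i = 1 then 1 else - 1) = e i" for i using e[of i] by (auto simp: \<eta>_def)
  have ee: "e i * e i = 1" for i using e[of i] by auto
  define G :: "real ^ 'p mod_ring ^ 'k \<Rightarrow> real ^ 'p mod_ring ^ 'k"
    where "G x = (\<chi> i. \<eta> i *\<^sub>R x $ s i)" for x
  have signed: "in_glue_coset (e i * c) (\<eta> i *\<^sub>R v)" if "in_glue_coset c v" for i c v
    using in_glue_coset_signed[OF that \<eta>(2)] e_eq by simp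
  have bij: "bij s" using s by (rule permutes_bij)
  have inj: "inj G"
  proof (rule injI)
    fix x y assume "G x = G y"
    then have "\<eta> i *\<^sub>R x $ s i = \<eta> i *\<^sub>R y $ s i" for i by (simp add: G_def vec_eq_iff)
    moreover have "\<eta> i \<noteq> 0" for i by (simp add: \<eta>_def)
    ultimately have "x $ s i = y $ s i" for i using scaleR_left_imp_eq by blast
    then show "x = y" using bij by (metis bij_def surjD vec_eq_iff)
  qed
  have "G ` construction_A C = construction_A D"
  proof
    show "G ` construction_A C \<subseteq> construction_A D"
      using signed
      by (fastforce simp: mem_construction_A_iff D G_def signed_perm_def)
    show "construction_A D \<subseteq> G ` construction_A C"
    proof
      fix y assume "y \<in> construction_A D"
      then obtain c where c: "c \<in> C" "\<And>j. in_glue_coset (e j * c $ s j) (y $ j)"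
        by (auto simp: mem_construction_A_iff D signed_perm_def)
      define t where "t = inv_into UNIV s"
      have t: "s (t i) = i" "t (s i) = i" for i
        using permutes_inverses[OF s] by (simp_all add: t_def)
      \<comment> \<open>The preimage of \<open>y\<close> under \<open>G\<close>: components are
        moved back by \<open>t\<close>, and the signs are their own inverses.\<close>
      define x where "x = (\<chi> i. \<eta> (t i) *\<^sub>R y $ t i)"
      have "in_glue_coset (c $ i) (x $ i)" for i
        using signed[OF c(2)[of "t i"], of "t i"] ee[of "t i"] t
        by (simp add: x_def mult.assoc[symmetric])
      then have "x \<in> construction_A C" using c(1) by (auto simp: mem_construction_A_iff)
      moreover have "G x = y" using t \<eta>(1) by (simp add: G_def x_def vec_eq_iff)
      ultimately show "y \<in> G ` construction_A C" by blast
    qed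
  qed
  then have "bij_betw G (construction_A C) (construction_A D)"
    using inj by (auto simp: bij_betw_def intro: inj_on_subset)
  moreover have "G (x + y) = G x + G y" for x y
    by (simp add: G_def vec_eq_iff algebra_simps)
  moreover have "G x \<bullet> G y = x \<bullet> y" for x y
  proof -
    have "G x \<bullet> G y = (\<Sum>i\<in>UNIV. x $ s i \<bullet> y $ s i)"
      unfolding inner_vec_def[of "G x"] using \<eta>(1)
      by (intro sum.cong) (auto simp: G_def mult.assoc[symmetric])
    also have "\<dots> = (\<Sum>i\<in>UNIV. x $ i \<bullet> y $ i)"
      using bij by (rule sum.reindex_bij_betw)
    finally show ?thesis by (simp add: inner_vec_def[of x])
  qed
  ultimately show ?thesis unfolding lattice_isomorphic_iff lattice_iso_def by blast
qed

theorem theorem3p1: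
  fixes C D :: "('p::prime_card mod_ring ^ 'k) set"
  assumes "odd CARD('p)"
    and "vec.subspace C" and "self_orthogonal C"
    and "vec.subspace D" and "self_orthogonal D"
  shows "lattice_isomorphic (construction_A C) (construction_A D) \<longleftrightarrow> code_isomorphic C D"
  using code_isomorphic_if_lattice_isomorphic[OF assms] lattice_isomorphic_if_code_isomorphic
  by blast

end
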